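(* Let $(u_0,\rho_0)\in T_{(\mathrm{id},0)}\mathcal M_{AC}=H_0^1(S^1)\times L_2(S^1)$. Let $c=\frac14\int_{S^1}(u_{0x}^2-\rho_0^2)\,dx$ and assume that (A) $c=-1$, (B) $|\rho_0(x)|\le u_{0x}(x)+2$ for a.e. $x\in S^1$. Define $\varphi(t,x)$ and $\alpha(t,x)$ by $$\varphi(t,x):=\int_0^x\bigl(f_1^2(t,y)-f_2^2(t,y)\bigr)dy,\qquad \alpha(t,x):=2\,\mathrm{arctanh}\frac{f_2(t,x)}{f_1(t,x)}=\rho_0(x)\int_0^t\frac{ds}{\varphi_x(s,x)},$$ where $$f_1(t,x):=\cosh t+\frac{u_{0x}(x)}{2}\sinh t,\qquad f_2(t,x):=\frac{\rho_0(x)}{2}\sinh t,\qquad (t,x)\in[0,\infty)\times S^1.$$ Then the following statements are true. (i) For each time $t\ge0$, $(\varphi(t,\cdot),\alpha(t,\cdot))\in\mathcal M_{AC}$. (ii) For each time $t\ge0$, $(\varphi_t(t,\cdot),\alpha_t(t,\cdot))\in T_{(\varphi,\alpha)}\mathcal M_{AC}$. (iii) The geodesic has constant energy for all $t\in[0,\infty)$; more precisely, $$\langle(\varphi_t,\alpha_t),(\varphi_t,\alpha_t)\rangle_{(\varphi,\alpha)}=-1,\qquad t\ge0.$$ (iv) The geodesic equation holds for all $t\in[0,\infty)$: $$\begin{pmatrix}\varphi_{tt}\\ \alpha_{tt}\end{pmatrix}=\Gamma_{(\varphi,\alpha)}\bigl((\varphi_t,\alpha_t),(\varphi_t,\alpha_t)\bigr),\qquad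 t\ge0.$$
   Context: $S^1\simeq\mathbb R/\mathbb Z$, and functions on $S^1$ are identified with functions on $[0,1]$ where needed. $H_0^1(S^1)=\{u\in H^1(S^1):u(0)=0\}$. $M^{AC}$ is the set of nondecreasing absolutely continuous functions $\varphi:[0,1]\to[0,1]$ with $\varphi(0)=0$ and $\varphi(1)=1$, and $\mathcal M_{AC}:=M^{AC}\circledS L_2(S^1)$ (pairs $(\varphi,\alpha)$ with $\varphi\in M^{AC}$, $\alpha\in L_2(S^1)$). The tangent space at the identity is $T_{(\mathrm{id},0)}\mathcal M_{AC}:=H_0^1(S^1)\times L_2(S^1)$, and at a general point $$T_{(\varphi,\alpha)}\mathcal M_{AC}:=\{(u\circ\varphi,\rho\circ\varphi):(u,\rho)\in T_{(\mathrm{id},0)}\mathcal M_{AC}\}.$$ For $(U,R),(V,S)\in T_{(\varphi,\alpha)}\mathcal M_{AC}$ the indefinite metric is $$\langle(U,R),(V,S)\rangle_{(\varphi,\alpha)}=\frac14\int_{S^1\setminus N}\Bigl(\frac{U_xV_x}{\varphi_x}-RS\,\varphi_x\Bigr)dx,\qquad N:=\{x\in S^1:\varphi_x(x)\text{ exists and equals }0\}.$$ The Christoffel operator on $\mathcal M_{AC}$ is $$\Gamma_{(\varphi,\alpha)}((U,R),(V,S))=\frac12\begin{pmatrix}\int_0^{\varphi(\cdot)}(u_xv_x-\rho\sigma)\,dx-\varphi(\cdot)\int_{S^1}(u_xv_x-\rho\sigma)\,dx\\-(u_x\sigma+v_x\rho)\circ\varphi\end{pmatrix},$$ where $(u,\rho),(v,\sigma)\in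 H_0^1(S^1)\times L_2(S^1)$ are chosen such that $(U,R)=(u,\rho)\circ\varphi$ and $(V,S)=(v,\sigma)\circ\varphi$. *)

theory Defs
  imports "HOL-Analysis.Analysis"
begin

text \<open>
  The circle is \<open>\<real>/\<int>\<close>, and a function on it is identified with a function on \<open>[0,1]\<close>.
  Such a function is represented by a total \<open>f :: real \<Rightarrow> real\<close> of which only the values on
  \<open>{0..1}\<close> matter; an element of \<open>L\<^sub>2\<close> is represented by any function in its class, and
  equality in \<open>L\<^sub>2\<close> is equality almost everywhere.
\<close>

abbreviation circle_measure :: "real measure" where
  "circle_measure \<equiv> lebesgue_on {0..1}"

text \<open>
  Classical derivatives \<open>f\<^sub>x\<close> (space, one-sided at \<open>0\<close> and \<open>1\<close>) and \<open>F\<^sub>t\<close> (time, one-sided at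
  \<open>t = 0\<close>); the time argument of \<open>F\<close> comes first. Both are arbitrary where the derivative
  does not exist.
\<close>

definition xderiv :: "(real \<Rightarrow> real) \<Rightarrow> real \<Rightarrow> real" where
  "xderiv f x = vector_derivative f (at x within {0..1})"

definition tderiv :: "(real \<Rightarrow> real \<Rightarrow> real) \<Rightarrow> real \<Rightarrow> real \<Rightarrow> real" where
  "tderiv F t x = vector_derivative (\<lambda>s. F s x) (at t within {0..})"

text \<open>A pair \<open>(a, b)\<close> in \<open>P\<close> stands for the interval with end points \<open>a \<le> b\<close>.\<close>

definition abs_continuous :: "(real \<Rightarrow> real) \<Rightarrow> bool" where
  "abs_continuous f \<longleftrightarrow>
     (\<forall>e>0. \<exists>d>0. \<forall>P. finite P \<and> (\<forall>(a, b)\<in>P. 0 \<le> a \<and> a \<le> b \<and> b \<le> 1) \<and>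
        pairwise (\<lambda>(a, b) (a', b'). disjnt {a<..<b} {a'<..<b'}) P \<and>
        (\<Sum>(a, b)\<in>P. b - a) < d
        \<longrightarrow> (\<Sum>(a, b)\<in>P. \<bar>f b - f a\<bar>) < e)"

definition L2 :: "(real \<Rightarrow> real) set" where
  "L2 = {f \<in> borel_measurable circle_measure. integrable circle_measure (\<lambda>x. (f x)\<^sup>2)}"

text \<open>
  \<open>H\<^sup>1\<close> of the circle is described by continuous representatives: absolutely continuous
  periodic functions with square integrable derivative. Almost everywhere differentiability is
  a consequence of absolute continuity; it is listed because \<^const>\<open>xderiv\<close> is meaningful only
  where the derivative exists.
\<close>

definition H1_0 :: "(real \<Rightarrow> real) set" where
  "H1_0 = {u. abs_continuous u \<and> u 0 = u 1 \<and>
              (AE x in circle_measure. u differentiable (at x within {0..1})) \<and>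
              xderiv u \<in> L2 \<and> u 0 = 0}"

definition M_AC_fun :: "(real \<Rightarrow> real) set" where
  "M_AC_fun = {\<phi>. \<phi> \<in> {0..1} \<rightarrow> {0..1} \<and> mono_on {0..1} \<phi> \<and> abs_continuous \<phi> \<and>
                  \<phi> 0 = 0 \<and> \<phi> 1 = 1}"

type_synonym fun_pair = "(real \<Rightarrow> real) \<times> (real \<Rightarrow> real)"

definition M_AC :: "fun_pair set" where
  "M_AC = M_AC_fun \<times> L2"

definition T_id :: "fun_pair set" where
  "T_id = H1_0 \<times> L2"

text \<open>\<open>(U, R) = (u \<circ> \<phi>, \<rho> \<circ> \<phi>)\<close>, the second component as functions defined almost everywhere.\<close>

fun right_translate :: "(real \<Rightarrow> real) \<Rightarrow> fun_pair \<Rightarrow> fun_pair \<Rightarrow> bool" where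
  "right_translate \<phi> (u, \<rho>) (U, R) \<longleftrightarrow>
     (\<forall>x\<in>{0..1}. U x = u (\<phi> x)) \<and> (AE x in circle_measure. R x = \<rho> (\<phi> x))"

fun T_M_AC :: "fun_pair \<Rightarrow> fun_pair set" where
  "T_M_AC (\<phi>, \<alpha>) = {UR. \<exists>u\<rho>\<in>T_id. right_translate \<phi> u\<rho> UR}"

definition flat_set :: "(real \<Rightarrow> real) \<Rightarrow> real set" where
  "flat_set \<phi> = {x\<in>{0..1}. (\<phi> has_real_derivative 0) (at x within {0..1})}"

fun indef_metric :: "fun_pair \<Rightarrow> fun_pair \<Rightarrow> fun_pair \<Rightarrow> real" where
  "indef_metric (\<phi>, \<alpha>) (U, R) (V, S) =
     1 / 4 * (LINT x|lebesgue_on ({0..1} - flat_set \<phi>).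
                xderiv U x * xderiv V x / xderiv \<phi> x - R x * S x * xderiv \<phi> x)"

definition right_pullback :: "(real \<Rightarrow> real) \<Rightarrow> fun_pair \<Rightarrow> fun_pair" where
  "right_pullback \<phi> UR = (SOME u\<rho>. u\<rho> \<in> T_id \<and> right_translate \<phi> u\<rho> UR)"

fun christoffel_formula :: "(real \<Rightarrow> real) \<Rightarrow> fun_pair \<Rightarrow> fun_pair \<Rightarrow> fun_pair" where
  "christoffel_formula \<phi> (u, \<rho>) (v, \<sigma>) =
     (\<lambda>x. 1 / 2 * ((LINT y|lebesgue_on {0..\<phi> x}. xderiv u y * xderiv v y - \<rho> y * \<sigma> y)
                   - \<phi> x * (LINT y|circle_measure. xderiv u y * xderiv v y - \<rho> y * \<sigma> y)),
      \<lambda>x. 1 / 2 * (- (xderiv u (\<phi> x) * \<sigma> (\<phi> x) + xderiv v (\<phi> x) * \<rho> (\<phi> x))))"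

text \<open>
  The Christoffel operator: \<open>(u, \<rho>)\<close> and \<open>(v, \<sigma>)\<close> are chosen with \<open>(U, R) = (u, \<rho>) \<circ> \<phi>\<close> and
  \<open>(V, S) = (v, \<sigma>) \<circ> \<phi>\<close>; it is meaningful for tangent vectors \<open>(U, R)\<close>, \<open>(V, S)\<close> only.
\<close>

fun christoffel :: "fun_pair \<Rightarrow> fun_pair \<Rightarrow> fun_pair \<Rightarrow> fun_pair" where
  "christoffel (\<phi>, \<alpha>) UR VS =
     christoffel_formula \<phi> (right_pullback \<phi> UR) (right_pullback \<phi> VS)"

end

theory Submission imports Defs begin

text \<open>
  Put \<open>a = u\<^sub>0\<^sub>x / 2\<close> and \<open>b = \<rho>\<^sub>0 / 2\<close>. Then \<open>\<phi>\<^sub>x = P Q\<close> and \<open>\<alpha> = ln P - ln Q\<close> with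
  \<open>P = cosh t + (a + b) sinh t\<close> and \<open>Q = cosh t + (a - b) sinh t\<close>. Condition (B) says that
  \<open>a + b\<close> and \<open>a - b\<close> are at least \<open>-1\<close>, so \<open>P\<close> and \<open>Q\<close> are at least \<open>e\<^sup>-\<^sup>t\<close> and \<open>\<phi>\<close> is a
  homeomorphism of \<open>[0,1]\<close> with Lipschitz inverse, through which everything can be pulled back.
  The Wronskian identity \<open>P\<^sub>t Q - P Q\<^sub>t = \<rho>\<^sub>0\<close> gives \<open>\<alpha>\<^sub>t = \<rho>\<^sub>0 / \<phi>\<^sub>x\<close> and the pointwise relation
  \<open>\<phi>\<^sub>t\<^sub>x\<^sup>2 / \<phi>\<^sub>x - \<alpha>\<^sub>t\<^sup>2 \<phi>\<^sub>x = 4 P\<^sub>t Q\<^sub>t\<close>, whose right-hand side is a linear combination of \<open>1\<close>, \<open>a\<close> and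
  \<open>a\<^sup>2 - b\<^sup>2\<close>. It yields the square integrability of the velocity, the energy (since \<open>\<integral>a = 0\<close> and
  \<open>\<integral>(a\<^sup>2 - b\<^sup>2) = -1\<close>) and, because \<open>\<phi>\<^sub>t\<^sub>t\<^sub>x = 2 P\<^sub>t Q\<^sub>t + 2 P Q\<close>, the geodesic equation.
\<close>

section \<open>The Lebesgue differentiation theorem on the circle\<close>

text \<open>Lebesgue measure is complete, so measurability survives a change on a null set.
  Functions such as \<open>xderiv u\<close>, whose values are known only almost everywhere, get
  their measurability this way.\<close>

lemma borel_measurable_lebesgue_on_AE:
  fixes f g :: "'a::euclidean_space \<Rightarrow> 'b::euclidean_space"
  assumes f: "f \<in> borel_measurable (lebesgue_on S)" and S: "S \<in> sets lebesgue"
    and eq: "AE x in lebesgue_on S. f x = g x"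
  shows "g \<in> borel_measurable (lebesgue_on S)"
proof -
  have "AE x in lebesgue. (if x \<in> S then f x else 0) = (if x \<in> S then g x else 0)"
    using eq S by (simp add: AE_restrict_space_iff)
  then show ?thesis
    by (rule borel_measurable_if_D[OF borel_measurable_AE[OF borel_measurable_if_I[OF f S]]])
qed

lemma AE_circle_interior: "AE x in circle_measure. 0 < x \<and> x < 1"
proof -
  have "AE x in lebesgue. x \<notin> {0, 1::real}"
    by (rule AE_not_in) (simp add: negligible_iff_null_sets[symmetric])
  then show ?thesis
    by (auto simp: AE_restrict_space_iff)
qed

lemma integral_lebesgue_on_atLeastAtMost:
  fixes f :: "real \<Rightarrow> real"
  assumes "integrable circle_measure f" "{a..b} \<subseteq> {0..1}"
  shows "(LINT y|lebesgue_on {a..b}. f y) = integral {a..b} f"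
proof -
  have "integrable (lebesgue_on {a..b}) f"
    using assms by (metis integrable_subinterval)
  then show ?thesis
    by (simp add: lebesgue_integral_eq_integral)
qed

lemma integrable_circle_indicator:
  fixes f :: "real \<Rightarrow> real"
  assumes "integrable circle_measure f" "A \<in> sets borel"
  shows "integrable circle_measure (\<lambda>x. indicator A x * f x)"
proof (rule Bochner_Integration.integrable_bound[OF assms(1)])
  have "indicator A \<in> borel_measurable circle_measure"
    using assms(2) by (intro measurable_restrict_space1 measurable_completion borel_measurable_indicator) simp
  then show "(\<lambda>x. indicator A x * f x) \<in> borel_measurable circle_measure"
    using assms(1) by measurable
qed (auto simp: indicator_def)

text \<open>This is the differentiation theorem for cubes with lower corner \<open>x\<close>, read
  in dimension one. Such cubes are intervals to the right of \<open>x\<close>, hence the one-sided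
  conclusion.\<close>

lemma integrable_right_derivative:
  fixes f :: "real \<Rightarrow> real"
  assumes "\<And>a b. f integrable_on {a..b}"
  shows "AE x in lebesgue. \<forall>e>0. \<exists>d>0. \<forall>h. 0 < h \<and> h < d \<longrightarrow>
           \<bar>integral {x..x + h} f / h - f x\<bar> < e"
proof -
  have "\<And>a b. f integrable_on cbox a b"
    using assms by simp
  then obtain N where N: "negligible N"
    and *: "\<And>x e. \<lbrakk>x \<notin> N; 0 < e\<rbrakk> \<Longrightarrow> \<exists>d>0. \<forall>h. 0 < h \<and> h < d \<longrightarrow>
        norm (integral (cbox x (x + h *\<^sub>R One)) f /\<^sub>R h ^ DIM(real) - f x) < e"
    by (rule integrable_ccontinuous_explicit[where f=f]) blast
  have "AE x in lebesgue. x \<notin> N"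
    using N by (simp add: AE_not_in negligible_iff_null_sets)
  then show ?thesis
    by eventually_elim (use * in \<open>simp add: divide_inverse mult.commute\<close>)
qed

text \<open>A right difference quotient of the reflected function at \<open>- x\<close> is a left
  difference quotient of the function at \<open>x\<close>. The one-sided lemma, used for both
  functions, therefore gives the two-sided derivative at almost every interior point.\<close>

theorem lebesgue_differentiation:
  fixes f :: "real \<Rightarrow> real"
  assumes f: "integrable circle_measure f"
  shows "AE x in circle_measure.
    ((\<lambda>x. LINT y|lebesgue_on {0..x}. f y) has_real_derivative f x) (at x within {0..1})"
proof -
  \<comment> \<open>Extension by zero makes the function integrable on every interval of the
    line.\<close>
  define h where "h = (\<lambda>x. if x \<in> {0..1} then f x else 0)"
  have h: "integrable lebesgue h"
    unfolding h_def using f by (simp add: Lebesgue_Measure.integrable_restrict_UNIV del: atLeastAtMost_iff)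
  have hi: "h integrable_on {a..b}" for a b
    using integrable_on_lebesgue[OF h] integrable_on_subinterval[of h UNIV a b] by auto
  define R where "R = (\<lambda>g x. \<forall>e>0. \<exists>d>0. \<forall>t. 0 < t \<and> t < d \<longrightarrow>
           \<bar>integral {x..x + t} g / t - g x\<bar> < (e::real))" for g :: "real \<Rightarrow> real"
  have hi': "(\<lambda>x. h (- x)) integrable_on {a..b}" for a b
    using Henstock_Kurzweil_Integration.integrable_reflect_real[where f=h and a="-b" and b="-a"] hi[of "-b" "-a"] by simp
  have r1: "AE x in lebesgue. R h x"
    unfolding R_def by (rule integrable_right_derivative) (rule hi)
  have "AE x in lebesgue. R (\<lambda>x. h (- x)) x"
    unfolding R_def by (rule integrable_right_derivative) (rule hi')
  \<comment> \<open>The exceptional set of the reflected function must itself be reflected back.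
    Negation is differentiable and keeps it null.\<close>
  then obtain N where "N \<in> null_sets lebesgue" "\<And>x. x \<notin> N \<Longrightarrow> R (\<lambda>x. h (- x)) x"
    by (auto simp: completion.AE_iff_null_sets)
  then have N: "uminus ` N \<in> null_sets lebesgue" and NR: "\<And>x. x \<notin> uminus ` N \<Longrightarrow> R (\<lambda>x. h (- x)) (- x)"
    using negligible_differentiable_image_negligible[of N uminus]
    by (force simp: negligible_iff_null_sets differentiable_on_def)+
  have r2: "AE x in lebesgue. R (\<lambda>x. h (- x)) (- x)"
    using AE_not_in[OF N] by eventually_elim (use NR in auto)
  define F where "F = (\<lambda>x. LINT y|lebesgue_on {0..x}. f y)"
  have F: "F x = integral {0..x} h" if "x \<in> {0..1}" for x
  proof -
    have "F x = integral {0..x} f"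
      unfolding F_def using that by (intro integral_lebesgue_on_atLeastAtMost[OF f]) auto
    also have "\<dots> = integral {0..x} h"
      using that by (intro integral_cong) (auto simp: h_def)
    finally show ?thesis .
  qed
  have Fdiff: "F b - F a = integral {a..b} h" if "0 \<le> a" "a \<le> b" "b \<le> 1" for a b
    using Henstock_Kurzweil_Integration.integral_combine[of 0 a b h] that hi F by auto
  have main: "(F has_real_derivative f x) (at x within {0..1})"
    if r: "R h x" "R (\<lambda>x. h (- x)) (- x)" and x: "0 < x" "x < 1" for x
  proof -
    have "(\<lambda>t. (F (x + t) - F x) / t) \<midarrow>0\<rightarrow> f x"
    proof (rule LIM_I)
      fix e :: real assume e: "0 < e"
      obtain d1 where d1: "d1 > 0" "\<And>t. 0 < t \<Longrightarrow> t < d1 \<Longrightarrow> \<bar>integral {x..x + t} h / t - h x\<bar> < e"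
        using r(1) e unfolding R_def by blast
      obtain d2 where d2: "d2 > 0" "\<And>t. 0 < t \<Longrightarrow> t < d2 \<Longrightarrow>
            \<bar>integral {-x..-x + t} (\<lambda>x. h (- x)) / t - h (- (- x))\<bar> < e"
        using r(2) e unfolding R_def by blast
      have hx: "h x = f x"
        using x by (simp add: h_def)
      show "\<exists>s>0. \<forall>t. t \<noteq> 0 \<and> norm (t - 0) < s \<longrightarrow> norm ((F (x + t) - F x) / t - f x) < e"
      proof (intro exI conjI allI impI)
        \<comment> \<open>The bounds \<open>x\<close> and \<open>1 - x\<close> keep
          \<open>x + t\<close> in the circle, where increments of \<open>F\<close> are integrals of
          \<open>h\<close>.\<close>
        show "0 < min (min d1 d2) (min x (1 - x))"
          using d1 d2 x by auto
        fix t :: real assume t: "t \<noteq> 0 \<and> norm (t - 0) < min (min d1 d2) (min x (1 - x))"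
        show "norm ((F (x + t) - F x) / t - f x) < e"
        proof (cases "t > 0")
          case True
          then have "F (x + t) - F x = integral {x..x + t} h"
            using t x by (intro Fdiff) auto
          then show ?thesis
            using d1(2)[of t] True t hx by auto
        next
          case False
          then have t': "0 < - t" "- t < d2"
            using t by auto
          have "F x - F (x + t) = integral {x + t..x} h"
            using t x False by (intro Fdiff) auto
          also have "\<dots> = integral {-x..-x + (- t)} (\<lambda>x. h (- x))"
            using Henstock_Kurzweil_Integration.integral_reflect_real[where f=h and b="x" and a="x + t"] by (simp add: add.commute)
          finally have eq: "(F (x + t) - F x) / t = integral {-x..-x + (- t)} (\<lambda>x. h (- x)) / (- t)"
            by (metis minus_diff_eq minus_divide_divide)
          show ?thesis
            unfolding eq using d2(2)[OF t'] hx by simp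
        qed
      qed
    qed
    then have "(F has_real_derivative f x) (at x)"
      by (simp add: DERIV_def)
    then show ?thesis
      by (rule DERIV_subset) simp
  qed
  have "AE x in circle_measure. R h x" "AE x in circle_measure. R (\<lambda>x. h (- x)) (- x)"
    using r1 r2 by (auto simp: AE_restrict_space_iff elim: eventually_mono)
  then show ?thesis
    using AE_circle_interior unfolding F_def[symmetric] by eventually_elim (use main in blast)
qed

section \<open>Absolutely continuous functions\<close>

text \<open>Two distinct pairs of \<open>P\<close> cannot both have \<open>x\<close> in their open
  interval. This is what bounds the integral over a whole disjoint family by the integral over the
  circle.\<close>

lemma sum_indicator_disjoint_le:
  fixes P :: "(real \<times> real) set"
  assumes "finite P" "pairwise (\<lambda>(a, b) (a', b'). disjnt {a<..<b} {a'<..<b'}) P"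
  shows "(\<Sum>(a, b)\<in>P. indicator {a<..<b} x) \<le> (1::real)"
proof -
  have "(\<Sum>(a, b)\<in>P. indicator {a<..<b} x) = (\<Sum>p\<in>P. if x \<in> {fst p<..<snd p} then 1 else 0 :: real)"
    by (intro sum.cong) (auto simp: indicator_def)
  also have "\<dots> = real (card {p\<in>P. x \<in> {fst p<..<snd p}})"
    using assms(1) by (simp add: sum.If_cases Int_def)
  also have "card {p\<in>P. x \<in> {fst p<..<snd p}} \<le> 1"
  proof -
    have "p = q" if "p \<in> P" "q \<in> P" "x \<in> {fst p<..<snd p}" "x \<in> {fst q<..<snd q}" for p q
      using pairwiseD[OF assms(2) that(1,2)] that(3,4) by (auto simp: disjnt_iff split_def)
    then show ?thesis
      using assms(1) by (auto simp: card_le_Suc0_iff_eq)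
  qed
  finally show ?thesis
    by simp
qed

text \<open>The excess of \<open>\<bar>f x\<bar>\<close> over \<open>n\<close> tends to zero
  pointwise and is dominated by \<open>\<bar>f x\<bar>\<close>. Up to a small error in the integral,
  an integrable function can thus be treated as bounded.\<close>

lemma tail_integral_small:
  fixes f :: "real \<Rightarrow> real"
  assumes f: "integrable M f" and e: "0 < e"
  obtains n :: nat where "(LINT x|M. max (\<bar>f x\<bar> - real n) 0) < e"
    and "integrable M (\<lambda>x. max (\<bar>f x\<bar> - real n) 0)"
proof -
  have "(\<lambda>n. LINT x|M. max (\<bar>f x\<bar> - real n) 0) \<longlonglongrightarrow> (LINT x|M. 0)"
  proof (rule integral_dominated_convergence)
    show "integrable M (\<lambda>x. \<bar>f x\<bar>)" "(\<lambda>x. 0) \<in> borel_measurable M"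
      using f by auto
    show "(\<lambda>x. max (\<bar>f x\<bar> - real n) 0) \<in> borel_measurable M" for n
      using f by measurable
    show "AE x in M. (\<lambda>n. max (\<bar>f x\<bar> - real n) 0) \<longlonglongrightarrow> 0"
    proof (rule AE_I2)
      fix x
      obtain m :: nat where "\<bar>f x\<bar> \<le> real m"
        using real_arch_simple by blast
      then have "\<forall>\<^sub>F n in sequentially. max (\<bar>f x\<bar> - real n) 0 = 0"
        by (intro eventually_sequentiallyI[of m]) auto
      then show "(\<lambda>n. max (\<bar>f x\<bar> - real n) 0) \<longlonglongrightarrow> 0"
        by (rule tendsto_eventually)
    qed
  qed auto
  then have "\<forall>\<^sub>F n in sequentially. (LINT x|M. max (\<bar>f x\<bar> - real n) 0) < e"
    using e by (intro order_tendstoD(2)) auto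
  then obtain n :: nat where "(LINT x|M. max (\<bar>f x\<bar> - real n) 0) < e"
    by (auto simp: eventually_sequentially)
  moreover have "integrable M (\<lambda>x. max (\<bar>f x\<bar> - real n) 0)"
    using f by (rule Bochner_Integration.integrable_bound) (use f in \<open>auto intro!: AE_I2\<close>)
  ultimately show ?thesis
    using that by blast
qed

lemma abs_continuousI:
  assumes "\<And>e. e > 0 \<Longrightarrow> \<exists>d>0. \<forall>P. finite P \<longrightarrow>
     (\<forall>(a, b)\<in>P. 0 \<le> a \<and> a \<le> b \<and> b \<le> 1) \<longrightarrow>
     pairwise (\<lambda>(a, b) (a', b'). disjnt {a<..<b} {a'<..<b'}) P \<longrightarrow>
     (\<Sum>(a, b)\<in>P. b - a) < d \<longrightarrow> (\<Sum>(a, b)\<in>P. \<bar>f b - f a\<bar>) < e"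
  shows "abs_continuous f"
  using assms unfolding abs_continuous_def by meson

lemma abs_continuousE:
  assumes "abs_continuous f" "0 < e"
  obtains d where "0 < d" "\<And>P. finite P \<Longrightarrow> (\<forall>(a, b)\<in>P. 0 \<le> a \<and> a \<le> b \<and> b \<le> 1) \<Longrightarrow>
     pairwise (\<lambda>(a, b) (a', b'). disjnt {a<..<b} {a'<..<b'}) P \<Longrightarrow>
     (\<Sum>(a, b)\<in>P. b - a) < d \<Longrightarrow> (\<Sum>(a, b)\<in>P. \<bar>f b - f a\<bar>) < e"
  using assms(1)[unfolded abs_continuous_def, rule_format, OF assms(2)] by blast

text \<open>Bound \<open>\<bar>f\<bar>\<close> by a constant \<open>n\<close> plus the excess over
  \<open>n\<close>. The excess contributes less than \<open>e / 2\<close> over any disjoint family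
  of intervals, and the constant contributes \<open>n\<close> times their total length.\<close>

theorem abs_continuous_integral:
  assumes f: "integrable circle_measure f"
    and F: "\<And>a b. 0 \<le> a \<Longrightarrow> a \<le> b \<Longrightarrow> b \<le> 1 \<Longrightarrow> F b - F a = (LINT y|lebesgue_on {a..b}. f y)"
  shows "abs_continuous F"
proof (rule abs_continuousI)
  fix e :: real assume e: "0 < e"
  obtain n :: nat where n: "(LINT x|circle_measure. max (\<bar>f x\<bar> - real n) 0) < e / 2"
    and tail: "integrable circle_measure (\<lambda>x. max (\<bar>f x\<bar> - real n) 0)"
    using tail_integral_small[OF f] e by (metis half_gt_zero)
  let ?g = "\<lambda>x. max (\<bar>f x\<bar> - real n) 0"
  have key: "\<bar>F b - F a\<bar> \<le> (LINT x|circle_measure. indicator {a<..<b} x * ?g x) + real n * (b - a)"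
    if "0 \<le> a" "a \<le> b" "b \<le> 1" for a b
  proof -
    have sub: "{a<..<b} \<inter> {0..1} = {a<..<b}" "{a..b} \<subseteq> {0..1}"
      using that by auto
    have int: "integrable (lebesgue_on {a..b}) f"
      using f that by (metis integrable_subinterval atLeastatMost_subset_iff)
    have em: "emeasure circle_measure {a<..<b} = ennreal (b - a)"
      using that by (subst emeasure_restrict_space) auto
    have ind: "integrable circle_measure (indicator {a<..<b} :: real \<Rightarrow> real)"
      by (rule integrable_real_indicator) (use sub em in \<open>auto simp: sets_restrict_space_iff\<close>)
    have indg: "integrable circle_measure (\<lambda>x. indicator {a<..<b} x * ?g x)"
      by (rule integrable_circle_indicator[OF tail]) simp
    \<comment> \<open>Disjointness in \<open>abs_continuous\<close> concerns open intervals only, so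
      the end points are removed as a null set.\<close>
    have "AE x in lebesgue. x \<notin> {a, b}"
      by (rule AE_not_in) (simp add: negligible_iff_null_sets[symmetric])
    then have ae: "AE x in lebesgue. indicator {a..b} x = (indicator {a<..<b} x :: real)"
      by eventually_elim (auto simp: indicator_def)
    have "\<bar>F b - F a\<bar> \<le> (LINT y|lebesgue_on {a..b}. \<bar>f y\<bar>)"
      unfolding F[OF that] by (rule integral_abs_bound)
    also have "\<dots> = (LINT x|lebesgue. indicator {a..b} x * \<bar>f x\<bar>)"
      by (simp add: integral_restrict_space)
    also have "\<dots> = (LINT x|circle_measure. indicator {a..b} x * \<bar>f x\<bar>)"
      using that by (subst integral_restrict_space) (auto intro!: Bochner_Integration.integral_cong simp: indicator_def)
    also have "\<dots> \<le> (LINT x|circle_measure. indicator {a<..<b} x * ?g x + real n * indicator {a<..<b} x)"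
    proof (rule integral_mono_AE)
      show "integrable circle_measure (\<lambda>x. indicator {a..b} x * \<bar>f x\<bar>)"
        using f by (intro integrable_circle_indicator) auto
      show "integrable circle_measure (\<lambda>x. indicator {a<..<b} x * ?g x + real n * indicator {a<..<b} x)"
        using indg ind by auto
      show "AE x in circle_measure. indicator {a..b} x * \<bar>f x\<bar>
              \<le> indicator {a<..<b} x * ?g x + real n * indicator {a<..<b} x"
        using ae by (auto simp: AE_restrict_space_iff indicator_def elim!: eventually_mono)
    qed
    also have "\<dots> = (LINT x|circle_measure. indicator {a<..<b} x * ?g x)
         + real n * (LINT x|circle_measure. indicator {a<..<b} x)"
      using indg ind by simp
    also have "(LINT x|circle_measure. indicator {a<..<b} x) = b - a"
      using sub that measure_eq_emeasure_eq_ennreal[OF _ em] by simp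
    finally show ?thesis .
  qed
  show "\<exists>d>0. \<forall>P. finite P \<longrightarrow> (\<forall>(a, b)\<in>P. 0 \<le> a \<and> a \<le> b \<and> b \<le> 1) \<longrightarrow>
     pairwise (\<lambda>(a, b) (a', b'). disjnt {a<..<b} {a'<..<b'}) P \<longrightarrow>
     (\<Sum>(a, b)\<in>P. b - a) < d \<longrightarrow> (\<Sum>(a, b)\<in>P. \<bar>F b - F a\<bar>) < e"
  proof (intro exI conjI allI impI)
    \<comment> \<open>The summand 1 avoids a zero denominator when \<open>n = 0\<close>.\<close>
    show "0 < e / (2 * (real n + 1))"
      using e by simp
    fix P :: "(real \<times> real) set"
    assume fin: "finite P" and P: "\<forall>(a, b)\<in>P. 0 \<le> a \<and> a \<le> b \<and> b \<le> 1"
      and pw: "pairwise (\<lambda>(a, b) (a', b'). disjnt {a<..<b} {a'<..<b'}) P"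
      and len: "(\<Sum>(a, b)\<in>P. b - a) < e / (2 * (real n + 1))"
    have indg: "integrable circle_measure (\<lambda>x. indicator {a<..<b} x * ?g x)" if "(a, b) \<in> P" for a b
      by (rule integrable_circle_indicator[OF tail]) simp
    have "(\<Sum>(a, b)\<in>P. \<bar>F b - F a\<bar>)
        \<le> (\<Sum>(a, b)\<in>P. (LINT x|circle_measure. indicator {a<..<b} x * ?g x) + real n * (b - a))"
      using P key by (intro sum_mono) auto
    also have "\<dots> = (\<Sum>(a, b)\<in>P. LINT x|circle_measure. indicator {a<..<b} x * ?g x)
                    + real n * (\<Sum>(a, b)\<in>P. b - a)"
      by (simp add: sum.distrib sum_distrib_left split_def)
    also have "(\<Sum>(a, b)\<in>P. LINT x|circle_measure. indicator {a<..<b} x * ?g x)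
        = (LINT x|circle_measure. (\<Sum>(a, b)\<in>P. indicator {a<..<b} x * ?g x))"
      unfolding split_def using indg by (subst Bochner_Integration.integral_sum) auto
    also have "\<dots> \<le> (LINT x|circle_measure. ?g x)"
    proof (rule integral_mono)
      show "integrable circle_measure (\<lambda>x. \<Sum>(a, b)\<in>P. indicator {a<..<b} x * ?g x)"
        unfolding split_def using indg by (intro Bochner_Integration.integrable_sum) auto
      show "(\<Sum>(a, b)\<in>P. indicator {a<..<b} x * ?g x) \<le> ?g x" for x
      proof -
        have "(\<Sum>(a, b)\<in>P. indicator {a<..<b} x * ?g x) = (\<Sum>(a, b)\<in>P. indicator {a<..<b} x) * ?g x"
          by (simp add: sum_distrib_right split_def)
        also have "\<dots> \<le> 1 * ?g x"
          using sum_indicator_disjoint_le[OF fin pw] by (intro mult_right_mono) auto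
        finally show ?thesis by simp
      qed
    qed (rule tail)
    also have "(LINT x|circle_measure. ?g x) < e / 2"
      by (rule n)
    also have "real n * (\<Sum>(a, b)\<in>P. b - a) \<le> e / 2"
    proof -
      have "real n * (\<Sum>(a, b)\<in>P. b - a) \<le> real n * (e / (2 * (real n + 1)))"
        using len by (intro mult_left_mono) auto
      also have "\<dots> \<le> e / 2"
        using e by (simp add: field_simps)
      finally show ?thesis .
    qed
    finally show "(\<Sum>(a, b)\<in>P. \<bar>F b - F a\<bar>) < e"
      by simp
  qed
qed

text \<open>A strictly increasing \<open>g\<close> carries a disjoint family of intervals to a
  disjoint family, and the total length grows at most by the factor \<open>C\<close>.\<close>

lemma abs_continuous_compose_Lipschitz:
  assumes h: "abs_continuous h" and C: "0 < C"
    and g: "\<And>x. x \<in> {0..1} \<Longrightarrow> g x \<in> {0..1}" "strict_mono_on {0..1} g"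
    and lip: "\<And>x y. 0 \<le> x \<Longrightarrow> x \<le> y \<Longrightarrow> y \<le> 1 \<Longrightarrow> g y - g x \<le> C * (y - x)"
  shows "abs_continuous (\<lambda>x. h (g x))"
proof (rule abs_continuousI)
  fix e :: real assume "0 < e"
  then obtain d where d: "d > 0" and hd: "\<And>P. finite P \<Longrightarrow> (\<forall>(a, b)\<in>P. 0 \<le> a \<and> a \<le> b \<and> b \<le> 1) \<Longrightarrow>
     pairwise (\<lambda>(a, b) (a', b'). disjnt {a<..<b} {a'<..<b'}) P \<Longrightarrow>
     (\<Sum>(a, b)\<in>P. b - a) < d \<Longrightarrow> (\<Sum>(a, b)\<in>P. \<bar>h b - h a\<bar>) < e"
    by (rule abs_continuousE[OF h]) blast
  have mono: "g x \<le> g y \<longleftrightarrow> x \<le> y" "g x < g y \<longleftrightarrow> x < y" if "x \<in> {0..1}" "y \<in> {0..1}" for x y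
    using g(2) that by (auto simp: strict_mono_on_less_eq strict_mono_on_less)
  show "\<exists>d>0. \<forall>P. finite P \<longrightarrow> (\<forall>(a, b)\<in>P. 0 \<le> a \<and> a \<le> b \<and> b \<le> 1) \<longrightarrow>
     pairwise (\<lambda>(a, b) (a', b'). disjnt {a<..<b} {a'<..<b'}) P \<longrightarrow>
     (\<Sum>(a, b)\<in>P. b - a) < d \<longrightarrow> (\<Sum>(a, b)\<in>P. \<bar>h (g b) - h (g a)\<bar>) < e"
  proof (intro exI conjI allI impI)
    show "0 < d / C"
      using d C by simp
    fix P :: "(real \<times> real) set"
    assume fin: "finite P" and P: "\<forall>(a, b)\<in>P. 0 \<le> a \<and> a \<le> b \<and> b \<le> 1"
      and pw: "pairwise (\<lambda>(a, b) (a', b'). disjnt {a<..<b} {a'<..<b'}) P"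
      and len: "(\<Sum>(a, b)\<in>P. b - a) < d / C"
    let ?G = "map_prod g g"
    have inj: "inj_on ?G P"
    proof (rule inj_onI)
      fix p q assume pq: "p \<in> P" "q \<in> P" "?G p = ?G q"
      obtain a b a' b' where "p = (a, b)" "q = (a', b')"
        by (meson surj_pair)
      moreover from this have "a \<in> {0..1}" "b \<in> {0..1}" "a' \<in> {0..1}" "b' \<in> {0..1}"
        using pq P by auto
      ultimately show "p = q"
        using pq(3) g(2) by (simp add: strict_mono_on_eq)
    qed
    have "(\<Sum>(a, b)\<in>?G ` P. \<bar>h b - h a\<bar>) < e"
    proof (rule hd)
      show "finite (?G ` P)"
        using fin by simp
      show "\<forall>(a, b)\<in>?G ` P. 0 \<le> a \<and> a \<le> b \<and> b \<le> 1"
      proof clarsimp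
        fix a b assume "(a, b) \<in> P"
        then have "0 \<le> a" "a \<le> b" "b \<le> 1"
          using P by auto
        then show "0 \<le> g a \<and> g a \<le> g b \<and> g b \<le> 1"
          using g(1)[of a] g(1)[of b] mono(1)[of a b] by auto
      qed
      show "pairwise (\<lambda>(a, b) (a', b'). disjnt {a<..<b} {a'<..<b'}) (?G ` P)"
      proof (clarsimp simp: pairwise_def)
        fix a b a' b' assume ab: "(a, b) \<in> P" "(a', b') \<in> P" "g a = g a' \<longrightarrow> g b \<noteq> g b'"
        then have "(a, b) \<noteq> (a', b')"
          by auto
        from pairwiseD[OF pw ab(1,2) this] have "disjnt {a<..<b} {a'<..<b'}"
          by simp
        have r: "a \<in> {0..1}" "b \<in> {0..1}" "a' \<in> {0..1}" "b' \<in> {0..1}"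
          using P ab by auto
        \<comment> \<open>Disjoint open intervals are either ordered or one of them is empty. Each
          alternative is an inequality between end points, hence preserved by
          \<open>g\<close>.\<close>
        have "b \<le> a \<or> b' \<le> a' \<or> b \<le> a' \<or> b' \<le> a"
        proof (rule ccontr)
          assume "\<not> (b \<le> a \<or> b' \<le> a' \<or> b \<le> a' \<or> b' \<le> a)"
          then obtain z where "max a a' < z" "z < min b b'"
            using dense[of "max a a'" "min b b'"] by auto
          then show False
            using \<open>disjnt {a<..<b} {a'<..<b'}\<close> by (auto simp: disjnt_iff)
        qed
        then have "g b \<le> g a \<or> g b' \<le> g a' \<or> g b \<le> g a' \<or> g b' \<le> g a"
          using mono(1) r by blast
        then show "disjnt {g a<..<g b} {g a'<..<g b'}"
          by (auto simp: disjnt_iff)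
      qed
      have "(\<Sum>(a, b)\<in>?G ` P. b - a) = (\<Sum>(a, b)\<in>P. g b - g a)"
        by (subst sum.reindex[OF inj]) (auto simp: split_def)
      also have "\<dots> \<le> (\<Sum>(a, b)\<in>P. C * (b - a))"
        using P lip by (intro sum_mono) auto
      also have "\<dots> = C * (\<Sum>(a, b)\<in>P. b - a)"
        by (simp add: sum_distrib_left split_def)
      also have "\<dots> < d"
        using len C by (simp add: field_simps)
      finally show "(\<Sum>(a, b)\<in>?G ` P. b - a) < d" .
    qed
    then show "(\<Sum>(a, b)\<in>P. \<bar>h (g b) - h (g a)\<bar>) < e"
      by (subst (asm) sum.reindex[OF inj]) (auto simp: split_def)
  qed
qed

text \<open>
  The straddle lemma controls the tags outside \<open>N\<close>. The gauge keeps the intervals with tags in \<open>N\<close>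
  inside an open set of small measure, so absolute continuity bounds their increments.
\<close>

lemma abs_continuous_has_integral:
  fixes f f' :: "real \<Rightarrow> real"
  assumes ac: "abs_continuous f" and N: "negligible N"
    and der: "\<And>x. x \<in> {0..1} - N \<Longrightarrow> (f has_vector_derivative f' x) (at x within {0..1})"
    and zero: "\<And>x. x \<in> N \<Longrightarrow> f' x = 0"
  shows "(f' has_integral (f 1 - f 0)) {0..1}"
  unfolding has_integral_factor_content_real
proof (intro allI impI)
  fix e :: real assume e: "e > 0"
  then have "\<forall>x. \<exists>d>0. x \<in> {0..1} - N \<longrightarrow>
         (\<forall>y\<in>{0..1}. norm (y-x) < d \<longrightarrow> norm (f y - f x - (y-x) *\<^sub>R f' x) \<le> (e / 2) * norm (y-x))"
    using der[unfolded has_vector_derivative_def has_derivative_within_alt] half_gt_zero by meson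
  then obtain d where d: "\<And>x. 0 < d x"
      "\<And>x y. \<lbrakk>x \<in> {0..1} - N; y \<in> {0..1}; norm (y-x) < d x\<rbrakk>
          \<Longrightarrow> norm (f y - f x - (y-x) *\<^sub>R f' x) \<le> (e / 2) * norm (y-x)"
    by metis
  obtain \<delta> where \<delta>: "\<delta> > 0" and ac': "\<And>P. finite P \<Longrightarrow> (\<forall>(a, b)\<in>P. 0 \<le> a \<and> a \<le> b \<and> b \<le> 1) \<Longrightarrow>
     pairwise (\<lambda>(a, b) (a', b'). disjnt {a<..<b} {a'<..<b'}) P \<Longrightarrow>
     (\<Sum>(a, b)\<in>P. b - a) < \<delta> \<Longrightarrow> (\<Sum>(a, b)\<in>P. \<bar>f b - f a\<bar>) < e / 2"
    by (rule abs_continuousE[OF ac half_gt_zero[OF e]]) blast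
  obtain T where T: "open T" "N \<subseteq> T" and TN: "T - N \<in> lmeasurable" "emeasure lebesgue (T - N) < ennreal \<delta>"
    using sets_lebesgue_outer_open[of N \<delta>] N \<delta> by (auto simp: negligible_iff_null_sets)
  have Tm: "T \<in> lmeasurable" and Tlt: "measure lebesgue T < \<delta>"
  proof -
    have "T = (T - N) \<union> N"
      using T by auto
    then show "T \<in> lmeasurable"
      using TN N by (metis fmeasurable.Un negligible_imp_measurable)
    have "measure lebesgue T = measure lebesgue (T - N)"
      using N by (metis measure_Diff_null_set negligible_iff_null_sets T(1) open_Int lborelD sets_completionI_sets borel_open sets_lborel)
    also have "\<dots> < \<delta>"
      using TN \<delta> by (simp add: emeasure_eq_measure2 ennreal_less_iff)
    finally show "measure lebesgue T < \<delta>" .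
  qed
  have "\<forall>x. \<exists>r>0. x \<in> N \<longrightarrow> ball x r \<subseteq> T"
    using T by (meson open_contains_ball subsetD zero_less_one)
  then obtain r where r: "\<And>x. 0 < r x" "\<And>x. x \<in> N \<Longrightarrow> ball x (r x) \<subseteq> T"
    by metis
  define s where "s = (\<lambda>x. if x \<in> N then r x else d x)"
  show "\<exists>d. gauge d \<and> (\<forall>p. p tagged_division_of {0..1} \<and> d fine p \<longrightarrow>
    norm ((\<Sum>(x, k)\<in>p. measure lborel k *\<^sub>R f' x) - (f 1 - f 0)) \<le> e * measure lborel {0..1::real})"
  proof (intro exI conjI allI impI)
    show "gauge (\<lambda>x. ball x (s x))"
      using d(1) r(1) by (simp add: s_def gauge_def)
    fix p assume "p tagged_division_of {0..1} \<and> (\<lambda>x. ball x (s x)) fine p"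
    then have ptag: "p tagged_division_of {0..1}" and fine: "(\<lambda>x. ball x (s x)) fine p"
      by auto
    have finp: "finite p"
      using ptag by blast
    have ba: "1 - 0 = (\<Sum>(x,K)\<in>p. Sup K - Inf K)" "f 1 - f 0 = (\<Sum>(x,K)\<in>p. f(Sup K) - f(Inf K))"
      using additive_tagged_division_1[where f= "\<lambda>x. x" and a=0 and b=1]
        additive_tagged_division_1[where f=f and a=0 and b=1] ptag by auto
    have K: "\<exists>u v. K = {u..v} \<and> 0 \<le> u \<and> u \<le> x \<and> x \<le> v \<and> v \<le> 1" if xK: "(x, K) \<in> p" for x K
    proof -
      obtain u v where k: "K = cbox u v" "x \<in> K" "K \<subseteq> {0..1}"
        using tagged_division_ofD(2,3,4)[OF ptag xK] by blast
      then show ?thesis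
        by (intro exI[of _ u] exI[of _ v]) auto
    qed
    have intK: "interior K = {Inf K<..<Sup K}" if xK: "(x, K) \<in> p" for x K
      using K[OF xK] by (auto simp: interior_atLeastAtMost_real)
    \<comment> \<open>Degenerate intervals are left out so that \<open>?E\<close> is injective on
      \<open>q\<close>: two different members with the same end points would have overlapping
      interiors.\<close>
    define q where "q = {(x, K) \<in> p. x \<in> N \<and> Inf K < Sup K}"
    have qp: "q \<subseteq> p"
      by (auto simp: q_def)
    let ?E = "\<lambda>(x, K). (Inf K, Sup K :: real)"
    have qdisj: "disjnt {Inf K<..<Sup K} {Inf K'<..<Sup K'}"
      if "(x, K) \<in> q" "(x', K') \<in> q" "(x, K) \<noteq> (x', K')" for x K x' K'
    proof -
      have "interior K \<inter> interior K' = {}"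
        using that qp ptag by (meson subsetD tagged_division_ofD(5))
      moreover have "interior K = {Inf K<..<Sup K}" "interior K' = {Inf K'<..<Sup K'}"
        using intK[of x K] intK[of x' K'] that qp by auto
      ultimately show ?thesis
        by (simp add: disjnt_def)
    qed
    have inj: "inj_on ?E q"
    proof (rule inj_onI)
      fix z w assume zw: "z \<in> q" "w \<in> q" "?E z = ?E w"
      obtain x K x' K' where [simp]: "z = (x, K)" "w = (x', K')"
        by (meson surj_pair)
      have "\<not> disjnt {Inf K<..<Sup K} {Inf K'<..<Sup K'}"
        using zw by (auto simp: q_def disjnt_def)
      then show "z = w"
        using qdisj[of x K x' K'] zw by auto
    qed
    have pw: "pairwise (\<lambda>(a, b) (a', b'). disjnt {a<..<b} {a'<..<b'}) (?E ` q)"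
      using qdisj by (fastforce simp: pairwise_def)
    have "(\<Sum>(a, b)\<in>?E ` q. \<bar>f b - f a\<bar>) < e / 2"
    proof (rule ac')
      show fin: "finite (?E ` q)"
        using finp qp finite_subset by blast
      show "\<forall>(a, b)\<in>?E ` q. 0 \<le> a \<and> a \<le> b \<and> b \<le> 1"
        using K qp by fastforce
      show "pairwise (\<lambda>(a, b) (a', b'). disjnt {a<..<b} {a'<..<b'}) (?E ` q)"
        by (rule pw)
      have "(\<Sum>(a, b)\<in>?E ` q. b - a) = (\<Sum>z\<in>?E ` q. measure lebesgue {fst z<..<snd z})"
        by (intro sum.cong) (auto simp: q_def)
      also have "\<dots> = measure lebesgue (\<Union>z\<in>?E ` q. {fst z<..<snd z})"
        using fin pw by (intro measure_UNION'[symmetric]) (auto simp: split_def)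
      also have "\<dots> \<le> measure lebesgue T"
      proof (rule measure_mono_fmeasurable)
        show "(\<Union>z\<in>?E ` q. {fst z<..<snd z}) \<subseteq> T"
        proof clarsimp
          fix x K y assume xK: "(x, K) \<in> q" and y: "Inf K < y" "y < Sup K"
          then have "x \<in> N" "(x, K) \<in> p"
            by (auto simp: q_def)
          then have "K \<subseteq> ball x (r x)"
            using fineD[OF fine, of x K] by (simp add: s_def)
          moreover have "y \<in> K"
            using K[OF \<open>(x, K) \<in> p\<close>] y by auto
          ultimately show "y \<in> T"
            using r(2)[OF \<open>x \<in> N\<close>] by blast
        qed
        show "(\<Union>z\<in>?E ` q. {fst z<..<snd z}) \<in> sets lebesgue"
          using fin by (intro sets.finite_UN) auto
      qed (rule Tm)
      also have "\<dots> < \<delta>"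
        by (rule Tlt)
      finally show "(\<Sum>(a, b)\<in>?E ` q. b - a) < \<delta>" .
    qed
    then have small: "(\<Sum>(x, K)\<in>q. \<bar>f (Sup K) - f (Inf K)\<bar>) < e / 2"
      by (subst (asm) sum.reindex[OF inj]) (simp add: split_def)
    have local_bound: "\<bar>measure lborel K *\<^sub>R f' x - (f (Sup K) - f (Inf K))\<bar>
        \<le> e / 2 * (Sup K - Inf K) + (if (x, K) \<in> q then \<bar>f (Sup K) - f (Inf K)\<bar> else 0)"
      if xK: "(x, K) \<in> p" for x K
    proof -
      obtain u v where k: "K = {u..v}" "0 \<le> u" "u \<le> x" "x \<le> v" "v \<le> 1"
        using K[OF xK] by blast
      then have uv: "u \<le> v" "Inf K = u" "Sup K = v" "measure lborel K = v - u"
        by auto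
      show ?thesis
      proof (cases "x \<in> N")
        \<comment> \<open>At a tag in \<open>N\<close> the Riemann term vanishes and the error is
          the increment itself, which is charged to \<open>q\<close>. A degenerate interval has no
          increment.\<close>
        case True
        then show ?thesis
          using zero[OF True] xK uv e mult_nonneg_nonneg[of "e / 2" "v - u"]
          by (cases "u = v") (auto simp: q_def abs_minus_commute)
      next
        case False
        then have b: "norm (u - x) < d x" "norm (v - x) < d x" and x: "x \<in> {0..1} - N"
          using subsetD[OF fineD[OF fine xK], of u] subsetD[OF fineD[OF fine xK], of v] k
          by (auto simp: s_def dist_real_def)
        have "\<bar>(v - u) * f' x - (f v - f u)\<bar>
            \<le> \<bar>f u - f x - (u - x) * f' x\<bar> + \<bar>f v - f x - (v - x) * f' x\<bar>"
          by (simp add: algebra_simps)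
        also have "\<dots> \<le> e / 2 * \<bar>u - x\<bar> + e / 2 * \<bar>v - x\<bar>"
          using d(2)[OF x _ b(1)] d(2)[OF x _ b(2)] k by (intro add_mono) auto
        also have "\<dots> = e / 2 * (v - u)"
          using k by (simp only: distrib_left[symmetric]) simp
        finally have "\<bar>measure lborel K *\<^sub>R f' x - (f (Sup K) - f (Inf K))\<bar> \<le> e / 2 * (Sup K - Inf K)"
          by (simp only: uv real_scaleR_def)
        then show ?thesis
          by (rule order_trans) simp
      qed
    qed
    have "norm ((\<Sum>(x, k)\<in>p. measure lborel k *\<^sub>R f' x) - (f 1 - f 0))
        = \<bar>\<Sum>(x, K)\<in>p. measure lborel K *\<^sub>R f' x - (f (Sup K) - f (Inf K))\<bar>"
      unfolding ba(2) by (simp add: split_def sum_subtractf)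
    also have "\<dots> \<le> (\<Sum>(x, K)\<in>p. \<bar>measure lborel K *\<^sub>R f' x - (f (Sup K) - f (Inf K))\<bar>)"
      unfolding split_def by (rule sum_abs)
    also have "\<dots> \<le> (\<Sum>z\<in>p. e / 2 * (Sup (snd z) - Inf (snd z)) +
                  (if z \<in> q then \<bar>f (Sup (snd z)) - f (Inf (snd z))\<bar> else 0))"
    proof (rule sum_mono)
      fix z assume "z \<in> p"
      then show "(case z of (x, K) \<Rightarrow> \<bar>measure lborel K *\<^sub>R f' x - (f (Sup K) - f (Inf K))\<bar>)
          \<le> e / 2 * (Sup (snd z) - Inf (snd z)) +
                  (if z \<in> q then \<bar>f (Sup (snd z)) - f (Inf (snd z))\<bar> else 0)"
        using local_bound[of "fst z" "snd z"] by (simp add: split_def)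
    qed
    also have "\<dots> = e / 2 * (\<Sum>(x, K)\<in>p. Sup K - Inf K) + (\<Sum>(x, K)\<in>q. \<bar>f (Sup K) - f (Inf K)\<bar>)"
      using finp qp by (simp add: sum.distrib sum_distrib_left split_def sum.If_cases Int_absorb1)
    also have "\<dots> \<le> e"
      using small ba(1) by simp
    finally show "norm ((\<Sum>(x, k)\<in>p. measure lborel k *\<^sub>R f' x) - (f 1 - f 0)) \<le> e * measure lborel {0..1::real}"
      by simp
  qed
qed

text \<open>The derivative is set to zero on the exceptional null set, as
  \<open>abs_continuous_has_integral\<close> demands, and then restored by a spike argument.
  Integrability of \<open>xderiv f\<close> identifies the gauge integral with the Lebesgue
  integral.\<close>

theorem abs_continuous_FTC:
  assumes ac: "abs_continuous f"
    and der: "AE x in circle_measure. f differentiable (at x within {0..1})"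
    and int: "integrable circle_measure (xderiv f)"
  shows "(LINT x|circle_measure. xderiv f x) = f 1 - f 0"
proof -
  have "AE x in lebesgue. x \<in> {0..1} \<longrightarrow> f differentiable (at x within {0..1})"
    using der by (simp add: AE_restrict_space_iff)
  then obtain N where N: "N \<in> null_sets lebesgue"
    "\<And>x. x \<notin> N \<Longrightarrow> x \<in> {0..1} \<Longrightarrow> f differentiable (at x within {0..1})"
    by (auto simp: completion.AE_iff_null_sets)
  have "((\<lambda>x. if x \<in> N then 0 else xderiv f x) has_integral (f 1 - f 0)) {0..1}"
    using ac by (rule abs_continuous_has_integral[where N=N])
      (use N in \<open>auto simp: negligible_iff_null_sets xderiv_def vector_derivative_works[symmetric]\<close>)
  then have "(xderiv f has_integral (f 1 - f 0)) {0..1}"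
    by (rule has_integral_spike[rotated 2, where S=N]) (use N in \<open>auto simp: negligible_iff_null_sets\<close>)
  then show ?thesis
    using has_integral_integral_lebesgue_on[OF int] has_integral_unique by auto
qed

section \<open>Change of variables along a homeomorphism of the circle\<close>

lemma integral_circle_indicator:
  fixes f :: "real \<Rightarrow> real"
  assumes "{a..b} \<subseteq> {0..1}"
  shows "(LINT x|circle_measure. indicator {a..b} x * f x) = (LINT x|lebesgue_on {a..b}. f x)"
proof -
  have "(LINT x|circle_measure. indicator {a..b} x * f x)
      = (LINT x|circle_measure. (if x \<in> {a..b} then f x else 0))"
    by (intro Bochner_Integration.integral_cong) (auto simp: indicator_def)
  also have "\<dots> = (LINT x|lebesgue_on {a..b}. f x)"
    using assms by (intro Lebesgue_Measure.integral_restrict) auto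
  finally show ?thesis .
qed

lemma integrable_circle_subinterval:
  fixes f :: "real \<Rightarrow> real"
  assumes "integrable circle_measure f" "0 \<le> a" "b \<le> 1"
  shows "integrable (lebesgue_on {a..b}) f"
  by (rule Equivalence_Lebesgue_Henstock_Integration.integrable_subinterval[OF assms(1)])
    (use assms in simp)

lemma integral_circle_diff:
  fixes f :: "real \<Rightarrow> real"
  assumes "integrable circle_measure f" "0 \<le> a" "a \<le> b" "b \<le> 1"
  shows "(LINT x|lebesgue_on {0..b}. f x) - (LINT x|lebesgue_on {0..a}. f x)
       = (LINT x|lebesgue_on {a..b}. f x)"
  using Equivalence_Measurable_On_Borel.integral_combine[OF
      integrable_circle_subinterval[OF assms(1), of 0 b] assms(2,3)] assms(4) by simp

lemma has_real_derivative_transform_on: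
  assumes "x \<in> S" "\<And>y. y \<in> S \<Longrightarrow> g y = f y" "(f has_real_derivative D) (at x within S)"
  shows "(g has_real_derivative D) (at x within S)"
  using assms unfolding has_field_derivative_def by (rule has_derivative_transform)

lemma xderiv_eqI:
  assumes "(f has_real_derivative D) (at x within {0..1})" "x \<in> {0..1}"
  shows "xderiv f x = D"
  using vector_derivative_within_cbox[of 0 1 x f D] assms
  unfolding xderiv_def has_real_derivative_iff_has_vector_derivative box_real by simp

text \<open>A Lebesgue measurable function composed with a continuous map may fail to be measurable.
  Compositions are therefore formed with a Borel representative, and
  \<open>AE_compose_\<phi>\<close> and \<open>AE_compose_\<psi>\<close> control the null set on
  which it differs.\<close>

lemma circle_borel_representative:
  fixes f :: "real \<Rightarrow> real"
  assumes "f \<in> borel_measurable circle_measure"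
  obtains f' where "f' \<in> borel_measurable borel" "AE x in circle_measure. f x = f' x"
proof -
  have "(\<lambda>x. if x \<in> {0..1} then f x else 0) \<in> borel_measurable lebesgue"
    by (rule borel_measurable_if_I[OF assms]) simp
  from completion_ex_borel_measurable_real[OF this]
  obtain f' where f': "f' \<in> borel_measurable lborel"
     "AE x in lborel. (if x \<in> {0..1} then f x else 0) = f' x"
    by blast
  from AE_completion[OF f'(2)] have "AE x in circle_measure. f x = f' x"
    by (auto simp: AE_restrict_space_iff elim: eventually_mono)
  then show ?thesis
    using that f'(1) by simp
qed

text \<open>This abstracts the flow at one fixed time, with \<open>g\<close> its spatial derivative.
  The lower bound \<open>k\<close> is what gives a Lipschitz inverse, while \<open>g\<close> may be
  unbounded and \<open>\<phi>\<close> itself only absolutely continuous.\<close>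

locale circle_homeomorphism =
  fixes \<phi> g :: "real \<Rightarrow> real" and k :: real
  assumes g_integrable: "integrable circle_measure g"
    and k_pos: "0 < k" and g_lower: "AE x in circle_measure. k \<le> g x"
    and \<phi>_eq: "\<And>x. x \<in> {0..1} \<Longrightarrow> \<phi> x = (LINT y|lebesgue_on {0..x}. g y)"
    and \<phi>_1: "\<phi> 1 = 1"
begin

section \<open>The homeomorphism and its inverse\<close>

lemma g_measurable [measurable]: "g \<in> borel_measurable circle_measure"
  using g_integrable by auto

lemma \<phi>_diff:
  assumes "0 \<le> a" "a \<le> b" "b \<le> 1"
  shows "\<phi> b - \<phi> a = (LINT y|lebesgue_on {a..b}. g y)"
  using integral_circle_diff[OF g_integrable assms] assms by (simp add: \<phi>_eq)

lemma \<phi>_expanding: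
  assumes "0 \<le> a" "a \<le> b" "b \<le> 1"
  shows "k * (b - a) \<le> \<phi> b - \<phi> a"
proof -
  have "k * (b - a) = (LINT y|lebesgue_on {a..b}. k)"
    using assms by (simp add: measure_restrict_space)
  also have "\<dots> \<le> (LINT y|lebesgue_on {a..b}. g y)"
  proof (rule integral_mono_AE)
    show "integrable (lebesgue_on {a..b}) (\<lambda>x. k)"
      by (intro finite_measure.integrable_const finite_measure_lebesgue_on) simp
    show "integrable (lebesgue_on {a..b}) g"
      using assms by (intro integrable_circle_subinterval[OF g_integrable]) auto
    show "AE x in lebesgue_on {a..b}. k \<le> g x"
      using g_lower assms by (auto simp: AE_restrict_space_iff elim!: eventually_mono)
  qed
  finally show ?thesis
    using \<phi>_diff[OF assms] by simp
qed

lemma \<phi>_0: "\<phi> 0 = 0"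
proof -
  have "{0::real} \<in> null_sets lebesgue"
    by (simp add: negligible_iff_null_sets[symmetric])
  then show ?thesis
    using \<phi>_eq[of 0] integral_eq_zero_null_sets[of "{0}" g] by (simp del: insert_null_sets_lebesgue_on_iff)
qed

lemma \<phi>_less:
  assumes "0 \<le> a" "a < b" "b \<le> 1"
  shows "\<phi> a < \<phi> b"
proof -
  have "0 < k * (b - a)"
    using k_pos assms by simp
  also have "\<dots> \<le> \<phi> b - \<phi> a"
    using assms by (intro \<phi>_expanding) auto
  finally show ?thesis
    by simp
qed

lemma \<phi>_strict_mono: "strict_mono_on {0..1} \<phi>"
  by (rule strict_mono_onI) (simp add: \<phi>_less)

lemma \<phi>_le_iff: "x \<in> {0..1} \<Longrightarrow> y \<in> {0..1} \<Longrightarrow> \<phi> x \<le> \<phi> y \<longleftrightarrow> x \<le> y"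
  using \<phi>_strict_mono by (simp add: strict_mono_on_less_eq)

lemma \<phi>_range: "x \<in> {0..1} \<Longrightarrow> \<phi> x \<in> {0..1}"
  using \<phi>_le_iff[of 0 x] \<phi>_le_iff[of x 1] unfolding \<phi>_0 \<phi>_1 by auto

lemma \<phi>_continuous: "continuous_on {0..1} \<phi>"
  using indefinite_integral_continuous_real[OF g_integrable]
  by (rule continuous_on_eq) (rule \<phi>_eq[symmetric])

lemma \<phi>_measurable [measurable]: "\<phi> \<in> borel_measurable circle_measure"
  by (rule continuous_imp_measurable_on_sets_lebesgue[OF \<phi>_continuous]) simp

lemma \<phi>_image: "\<phi> ` {0..1} = {0..1}"
proof
  show "\<phi> ` {0..1} \<subseteq> {0..1}"
    using \<phi>_range by blast
  show "{0..1} \<subseteq> \<phi> ` {0..1}"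
    using IVT'[of \<phi> 0 _ 1] \<phi>_continuous by (force simp: \<phi>_0 \<phi>_1)
qed

lemma \<phi>_M_AC: "\<phi> \<in> M_AC_fun"
proof -
  have "abs_continuous \<phi>"
    by (rule abs_continuous_integral[OF g_integrable \<phi>_diff])
  moreover have "mono_on {0..1} \<phi>"
    by (rule mono_onI) (simp add: \<phi>_le_iff)
  ultimately show ?thesis
    using \<phi>_range by (auto simp: M_AC_fun_def \<phi>_0 \<phi>_1)
qed

text \<open>The argument is clamped to \<open>{0..1}\<close> to make the inverse Borel measurable on the whole line.\<close>

definition \<psi> :: "real \<Rightarrow> real" where
  "\<psi> y = inv_into {0..1} \<phi> (min 1 (max 0 y))"

lemma \<psi>_in: "\<psi> y \<in> {0..1}" and \<phi>_\<psi>_clamp: "\<phi> (\<psi> y) = min 1 (max 0 y)"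
proof -
  have "min 1 (max 0 y) \<in> \<phi> ` {0..1}"
    unfolding \<phi>_image by auto
  then show "\<psi> y \<in> {0..1}" and "\<phi> (\<psi> y) = min 1 (max 0 y)"
    unfolding \<psi>_def by (blast intro: inv_into_into, blast intro: f_inv_into_f)
qed

lemma \<phi>_\<psi>: "y \<in> {0..1} \<Longrightarrow> \<phi> (\<psi> y) = y"
  by (simp add: \<phi>_\<psi>_clamp)

lemma \<phi>_inj: "x \<in> {0..1} \<Longrightarrow> y \<in> {0..1} \<Longrightarrow> \<phi> x = \<phi> y \<Longrightarrow> x = y"
  using \<phi>_strict_mono by (simp add: strict_mono_on_eq)

lemma \<psi>_\<phi>: "x \<in> {0..1} \<Longrightarrow> \<psi> (\<phi> x) = x"
  by (rule \<phi>_inj[OF \<psi>_in _ \<phi>_\<psi>[OF \<phi>_range]])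

lemma \<psi>_mono: "x \<le> y \<Longrightarrow> \<psi> x \<le> \<psi> y"
  using \<phi>_le_iff[OF \<psi>_in \<psi>_in, of x y] unfolding \<phi>_\<psi>_clamp by auto

lemma \<psi>_strict_mono: "strict_mono_on {0..1} \<psi>"
proof (rule strict_mono_onI)
  fix x y :: real assume xy: "x \<in> {0..1}" "y \<in> {0..1}" "x < y"
  then have "\<psi> x \<noteq> \<psi> y"
    by (metis \<phi>_\<psi> less_irrefl)
  then show "\<psi> x < \<psi> y"
    using \<psi>_mono[of x y] xy by simp
qed

text \<open>Clamping does not increase distances, and \<open>\<phi>\<close> expands them at least by
  the factor \<open>k\<close>.\<close>

lemma \<psi>_Lipschitz:
  assumes "x \<le> y"
  shows "\<psi> y - \<psi> x \<le> 1 / k * (y - x)"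
proof -
  have "k * (\<psi> y - \<psi> x) \<le> \<phi> (\<psi> y) - \<phi> (\<psi> x)"
    using \<psi>_in[of x] \<psi>_in[of y] \<psi>_mono[OF assms] by (intro \<phi>_expanding) auto
  also have "\<dots> \<le> y - x"
    using assms by (auto simp: \<phi>_\<psi>_clamp)
  finally show ?thesis
    using k_pos by (simp add: field_simps)
qed

lemma \<psi>_continuous: "continuous_on UNIV \<psi>"
proof -
  have "(1 / k)-lipschitz_on UNIV \<psi>"
  proof (rule lipschitz_onI)
    fix x y :: real
    show "dist (\<psi> x) (\<psi> y) \<le> 1 / k * dist x y"
      using \<psi>_Lipschitz[of x y] \<psi>_Lipschitz[of y x] \<psi>_mono[of x y] \<psi>_mono[of y x]
      by (cases "x \<le> y") (auto simp: dist_real_def)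
  qed (use k_pos in simp)
  then show ?thesis
    by (rule lipschitz_on_continuous_on)
qed

lemma \<psi>_borel [measurable]: "\<psi> \<in> borel_measurable borel"
  using \<psi>_continuous by (rule borel_measurable_continuous_onI)

section \<open>Push-forward of the density and transport of null sets\<close>

lemma g_nonneg: "AE x in circle_measure. 0 \<le> g x"
  using g_lower by eventually_elim (use k_pos in simp)

text \<open>This is the substitution \<open>y = \<phi> x\<close> in the form of measures. Half-lines
  suffice to compare the two sides: up to a null set, the preimage of \<open>{y<..}\<close> is
  \<open>{\<psi> y..1}\<close>, whose mass under the density is
  \<open>\<phi> 1 - \<phi> (\<psi> y)\<close>.\<close>

lemma distr_\<phi>:
  "distr (density circle_measure g) borel \<phi> = density lborel (indicator {0..1} :: real \<Rightarrow> real)"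
proof (rule measure_eqI_lessThan)
  let ?M1 = "distr (density circle_measure g) borel \<phi>"
  let ?M2 = "density lborel (indicator {0..1} :: real \<Rightarrow> real)"
  have *: "emeasure ?M1 {y<..} = ennreal (1 - min 1 (max 0 y))" for y
  proof -
    let ?a = "\<psi> y"
    have a: "0 \<le> ?a" "?a \<le> 1"
      using \<psi>_in[of y] by auto
    \<comment> \<open>Without \<open>?a\<close> the open and the closed interval agree. Without 0
      and 1 the value \<open>\<phi> x\<close> lies strictly between 0 and 1, so comparing it with
      \<open>y\<close> is the same as comparing it with the clamped \<open>y\<close>.\<close>
    have "AE x in lebesgue. x \<notin> {?a, 0, 1}"
      by (rule AE_not_in) (simp add: negligible_iff_null_sets[symmetric])
    then have "AE x in circle_measure. x \<notin> {?a, 0, 1}"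
      by (auto simp: AE_restrict_space_iff elim: eventually_mono)
    moreover have "AE x in circle_measure. x \<in> {0..1}"
      by (simp add: AE_restrict_space_iff)
    ultimately have ind: "AE x in circle_measure. indicator {y<..} (\<phi> x) = (indicator {?a..1} x :: real)"
    proof eventually_elim
      case (elim x)
      have "?a < x \<longleftrightarrow> \<phi> ?a < \<phi> x"
        using \<phi>_le_iff[OF elim(2) \<psi>_in[of y]] by (simp add: not_le[symmetric])
      moreover have "0 < \<phi> x" "\<phi> x < 1"
        using elim \<phi>_less[of 0 x] \<phi>_less[of x 1] by (auto simp: \<phi>_0 \<phi>_1)
      ultimately have "y < \<phi> x \<longleftrightarrow> ?a < x"
        using elim by (auto simp: \<phi>_\<psi>_clamp)
      then show ?case
        using elim by (auto simp: indicator_def)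
    qed
    have "{y<..} \<in> sets borel"
      by simp
    then have "emeasure ?M1 {y<..} = emeasure (density circle_measure g) (\<phi> -` {y<..} \<inter> space circle_measure)"
      by (subst emeasure_distr) auto
    also have "\<dots> = (\<integral>\<^sup>+x. ennreal (g x) * indicator (\<phi> -` {y<..} \<inter> space circle_measure) x \<partial>circle_measure)"
      by (rule emeasure_density) measurable
    also have "\<dots> = (\<integral>\<^sup>+x. ennreal (indicator {?a..1} x * g x) \<partial>circle_measure)"
    proof (rule nn_integral_cong_AE)
      show "AE x in circle_measure. ennreal (g x) * indicator (\<phi> -` {y<..} \<inter> space circle_measure) x
          = ennreal (indicator {?a..1} x * g x)"
        using ind AE_circle_interior by eventually_elim (auto simp: indicator_def split: if_splits)
    qed
    also have "\<dots> = ennreal (LINT x|circle_measure. indicator {?a..1} x * g x)"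
      using g_nonneg by (intro nn_integral_eq_integral integrable_circle_indicator g_integrable)
        (auto elim!: eventually_mono)
    also have "(LINT x|circle_measure. indicator {?a..1} x * g x) = \<phi> 1 - \<phi> ?a"
      using \<phi>_diff[of ?a 1] a by (simp add: integral_circle_indicator)
    finally show ?thesis
      by (simp add: \<phi>_1 \<phi>_\<psi>_clamp)
  qed
  show "emeasure ?M1 {y<..} < \<infinity>" for y
    unfolding * by simp
  show "emeasure ?M1 {y<..} = emeasure ?M2 {y<..}" for y
  proof -
    have "emeasure ?M2 {y<..} = (\<integral>\<^sup>+x. ennreal (indicator {0..1} x) * indicator {y<..} x \<partial>lborel)"
      by (rule emeasure_density) simp_all
    also have "\<dots> = (\<integral>\<^sup>+x. indicator ({0..1} \<inter> {y<..}) x \<partial>lborel)"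
      by (rule nn_integral_cong) (simp add: indicator_def)
    also have "\<dots> = emeasure lborel ({0..1} \<inter> {y<..})"
      by simp
    also have "{0..1} \<inter> {y<..} = (if y < 0 then {0..1} else {y<..1})"
      by auto
    also have "emeasure lborel (if y < 0 then {0..1} else {y<..1}) = ennreal (1 - min 1 (max 0 y))"
      by (auto simp: min_def max_def)
    finally show ?thesis
      unfolding * by simp
  qed
qed auto

lemma AE_density_circle: "(AE x in density lborel (indicator {0..1} :: real \<Rightarrow> real). Q x)
   \<longleftrightarrow> (AE x in circle_measure. Q x)"
proof -
  have "(AE x in density lborel (indicator {0..1} :: real \<Rightarrow> real). Q x)
      \<longleftrightarrow> (AE x in lborel. x \<in> {0..1} \<longrightarrow> Q x)"
    by (subst AE_density) (auto simp: indicator_def)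
  also have "\<dots> \<longleftrightarrow> (AE x in lebesgue. x \<in> {0..1} \<longrightarrow> Q x)"
    by (rule AE_completion_iff[symmetric])
  finally show ?thesis
    by (simp add: AE_restrict_space_iff)
qed

text \<open>Because \<open>g\<close> is positive almost everywhere, weighting by \<open>g\<close>
  creates no new null sets. Both \<open>\<phi>\<close> and \<open>\<psi>\<close> can therefore
  transport statements that hold almost everywhere.\<close>

lemma AE_density_g: "(AE x in density circle_measure g. Q x) \<longleftrightarrow> (AE x in circle_measure. Q x)"
proof -
  have "(AE x in density circle_measure g. Q x) \<longleftrightarrow> (AE x in circle_measure. 0 < ennreal (g x) \<longrightarrow> Q x)"
    by (rule AE_density) measurable
  also have "\<dots> \<longleftrightarrow> (AE x in circle_measure. Q x)"
  proof
    assume "AE x in circle_measure. 0 < ennreal (g x) \<longrightarrow> Q x"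
    with g_lower show "AE x in circle_measure. Q x"
      by eventually_elim (use k_pos in simp)
  qed (auto elim: eventually_mono)
  finally show ?thesis .
qed

lemma AE_compose_\<phi>:
  assumes "AE y in circle_measure. Q y"
  shows "AE x in circle_measure. Q (\<phi> x)"
proof -
  have "AE y in distr (density circle_measure g) borel \<phi>. Q y"
    using assms unfolding distr_\<phi> AE_density_circle .
  then have "AE x in density circle_measure g. Q (\<phi> x)"
    by (rule AE_distrD[where f=\<phi> and P=Q and M'=borel, rotated]) measurable
  then show ?thesis
    by (simp add: AE_density_g)
qed

text \<open>The exceptional set is enclosed in a Borel null set \<open>B\<close>, so that
  \<open>\<psi> y \<notin> B\<close> is a measurable condition. It can then be tested on the
  push-forward at \<open>y = \<phi> x\<close>, where \<open>\<psi>\<close> returns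
  \<open>x\<close>.\<close>

lemma AE_compose_\<psi>:
  assumes "AE x in circle_measure. Q x"
  shows "AE y in circle_measure. Q (\<psi> y)"
proof -
  have "AE x in lebesgue. x \<in> {0..1} \<longrightarrow> Q x"
    using assms by (simp add: AE_restrict_space_iff)
  then have "AE x in lborel. x \<in> {0..1} \<longrightarrow> Q x"
    by (simp only: AE_completion_iff)
  then obtain B where B: "B \<in> null_sets lborel" "\<And>x. x \<notin> B \<Longrightarrow> x \<in> {0..1} \<Longrightarrow> Q x"
    by (auto elim!: AE_E3)
  then have [measurable]: "B \<in> sets borel"
    by (auto simp: null_sets_def)
  have "AE x in circle_measure. x \<notin> B"
    using AE_completion[OF AE_not_in[OF B(1)]] by (auto simp: AE_restrict_space_iff elim: eventually_mono)
  moreover have "AE x in circle_measure. x \<in> {0..1}"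
    by (simp add: AE_restrict_space_iff)
  ultimately have "AE x in circle_measure. \<psi> (\<phi> x) \<notin> B"
    by eventually_elim (simp add: \<psi>_\<phi>)
  then have "AE y in distr (density circle_measure g) borel \<phi>. \<psi> y \<notin> B"
    by (subst AE_distr_iff) (simp_all add: AE_density_g)
  then have "AE y in circle_measure. \<psi> y \<notin> B"
    unfolding distr_\<phi> AE_density_circle .
  then show ?thesis
    by eventually_elim (use B(2) \<psi>_in in blast)
qed

section \<open>Measurability and integrals under substitution\<close>

lemma compose_\<phi>_measurable:
  fixes f :: "real \<Rightarrow> real"
  assumes "f \<in> borel_measurable circle_measure"
  shows "(\<lambda>x. f (\<phi> x)) \<in> borel_measurable circle_measure"
proof -
  obtain f' where [measurable]: "f' \<in> borel_measurable borel" and f': "AE x in circle_measure. f x = f' x"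
    using circle_borel_representative[OF assms] .
  have ae: "AE x in circle_measure. f' (\<phi> x) = f (\<phi> x)"
    using AE_compose_\<phi>[OF f'] by eventually_elim simp
  have m: "(\<lambda>x. f' (\<phi> x)) \<in> borel_measurable circle_measure"
    by measurable
  show ?thesis
    by (rule borel_measurable_lebesgue_on_AE[OF m _ ae]) simp
qed

lemma compose_\<psi>_measurable:
  fixes f :: "real \<Rightarrow> real"
  assumes "f \<in> borel_measurable circle_measure"
  shows "(\<lambda>x. f (\<psi> x)) \<in> borel_measurable circle_measure"
proof -
  obtain f' where [measurable]: "f' \<in> borel_measurable borel" and f': "AE x in circle_measure. f x = f' x"
    using circle_borel_representative[OF assms] .
  have ae: "AE x in circle_measure. f' (\<psi> x) = f (\<psi> x)"
    using AE_compose_\<psi>[OF f'] by eventually_elim simp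
  have m: "(\<lambda>x. f' (\<psi> x)) \<in> borel_measurable circle_measure"
    by (intro measurable_restrict_space1 measurable_completion) simp
  show ?thesis
    by (rule borel_measurable_lebesgue_on_AE[OF m _ ae]) simp
qed

text \<open>Integrability and value pass together through four equalities: from \<open>f\<close> to
  its Borel representative, from the completed measure to a density over \<open>lborel\<close>, by
  \<open>distr_\<phi>\<close> to the density \<open>g\<close>, and back from the representative to
  \<open>f\<close>.\<close>

theorem change_of_variables:
  fixes f :: "real \<Rightarrow> real"
  assumes f: "f \<in> borel_measurable circle_measure"
  shows "integrable circle_measure f \<longleftrightarrow> integrable circle_measure (\<lambda>x. g x * f (\<phi> x))"
    and "(LINT x|circle_measure. f x) = (LINT x|circle_measure. g x * f (\<phi> x))"
proof -
  obtain f' where [measurable]: "f' \<in> borel_measurable borel" and f': "AE x in circle_measure. f x = f' x"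
    using circle_borel_representative[OF f] .
  note f\<phi> = AE_compose_\<phi>[OF f']
  have [measurable]: "f' \<in> borel_measurable circle_measure"
    by (intro measurable_restrict_space1 measurable_completion) simp
  note [measurable] = f compose_\<phi>_measurable[OF f]
  let ?M = "density lborel (indicator {0..1} :: real \<Rightarrow> real)"
  have i1: "integrable circle_measure f \<longleftrightarrow> integrable circle_measure f'"
    and e1: "(LINT x|circle_measure. f x) = (LINT x|circle_measure. f' x)"
    by (rule integrable_cong_AE[OF f _ f'], measurable) (rule integral_cong_AE[OF f _ f'], measurable)
  have i2: "integrable circle_measure f' \<longleftrightarrow> integrable ?M f'"
  proof -
    have "integrable circle_measure f' \<longleftrightarrow> integrable lebesgue (\<lambda>x. indicator {0..1} x *\<^sub>R f' x)"
      by (rule integrable_restrict_space) simp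
    also have "\<dots> \<longleftrightarrow> integrable lborel (\<lambda>x. indicator {0..1} x *\<^sub>R f' x)"
      by (rule integrable_completion) measurable
    also have "\<dots> \<longleftrightarrow> integrable ?M f'"
      by (rule integrable_density[symmetric]) simp_all
    finally show ?thesis .
  qed
  have e2: "(LINT x|circle_measure. f' x) = (LINT x|?M. f' x)"
  proof -
    have "(LINT x|circle_measure. f' x) = (LINT x|lebesgue. indicator {0..1} x *\<^sub>R f' x)"
      by (rule integral_restrict_space) simp
    also have "\<dots> = (LINT x|lborel. indicator {0..1} x *\<^sub>R f' x)"
      by (rule integral_completion) measurable
    also have "\<dots> = (LINT x|?M. f' x)"
      by (rule integral_density[symmetric]) simp_all
    finally show ?thesis .
  qed
  have i3: "integrable ?M f' \<longleftrightarrow> integrable circle_measure (\<lambda>x. g x * f' (\<phi> x))"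
    using g_nonneg unfolding distr_\<phi>[symmetric]
    by (subst integrable_distr_eq) (auto simp: integrable_density)
  have e3: "(LINT x|?M. f' x) = (LINT x|circle_measure. g x * f' (\<phi> x))"
    using g_nonneg unfolding distr_\<phi>[symmetric]
    by (subst integral_distr) (auto simp: integral_density)
  have f'\<phi>: "AE x in circle_measure. g x * f' (\<phi> x) = g x * f (\<phi> x)"
    using f\<phi> by eventually_elim simp
  have i4: "integrable circle_measure (\<lambda>x. g x * f' (\<phi> x)) \<longleftrightarrow> integrable circle_measure (\<lambda>x. g x * f (\<phi> x))"
    using f'\<phi> by (intro integrable_cong_AE) measurable
  have e4: "(LINT x|circle_measure. g x * f' (\<phi> x)) = (LINT x|circle_measure. g x * f (\<phi> x))"
    using f'\<phi> by (intro integral_cong_AE) measurable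
  show "integrable circle_measure f \<longleftrightarrow> integrable circle_measure (\<lambda>x. g x * f (\<phi> x))"
    using i1 i2 i3 i4 by simp
  show "(LINT x|circle_measure. f x) = (LINT x|circle_measure. g x * f (\<phi> x))"
    using e1 e2 e3 e4 by simp
qed

text \<open>Monotonicity turns the indicator of \<open>{0..\<phi> x}\<close>, composed with
  \<open>\<phi>\<close>, into that of \<open>{0..x}\<close>.\<close>

lemma change_of_variables_initial:
  fixes f :: "real \<Rightarrow> real"
  assumes f: "integrable circle_measure f" and x: "x \<in> {0..1}"
  shows "(LINT y|lebesgue_on {0..\<phi> x}. f y) = (LINT y|lebesgue_on {0..x}. g y * f (\<phi> y))"
proof -
  have "{0..\<phi> x} \<subseteq> {0..1}"
    using \<phi>_range[OF x] by auto
  then have "(LINT y|lebesgue_on {0..\<phi> x}. f y) = (LINT y|circle_measure. indicator {0..\<phi> x} y * f y)"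
    by (rule integral_circle_indicator[symmetric])
  also have "\<dots> = (LINT y|circle_measure. g y * (indicator {0..\<phi> x} (\<phi> y) * f (\<phi> y)))"
    using integrable_circle_indicator[OF f, of "{0..\<phi> x}"] by (intro change_of_variables(2)) auto
  also have "\<dots> = (LINT y|circle_measure. indicator {0..x} y * (g y * f (\<phi> y)))"
    using x \<phi>_le_iff[of _ x] \<phi>_range
    by (intro Bochner_Integration.integral_cong) (auto simp: indicator_def)
  also have "\<dots> = (LINT y|lebesgue_on {0..x}. g y * f (\<phi> y))"
    using x by (intro integral_circle_indicator) auto
  finally show ?thesis .
qed

section \<open>Pulling derivatives and function spaces back to the identity\<close>

lemma \<phi>_has_derivative: "AE x in circle_measure. (\<phi> has_real_derivative g x) (at x within {0..1})"
proof -
  have "AE x in circle_measure. x \<in> {0..1}"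
    by (simp add: AE_restrict_space_iff)
  then show ?thesis
    using lebesgue_differentiation[OF g_integrable]
  proof eventually_elim
    case (elim x)
    show ?case
      by (rule has_real_derivative_transform_on[OF elim(1) _ elim(2)]) (simp add: \<phi>_eq)
  qed
qed

text \<open>On the circle any such \<open>u\<close> equals \<open>V\<close> composed with
  \<open>\<psi>\<close>, so the chain rule and the inverse function rule apply. The function
  \<open>u\<close> is left arbitrary because \<open>right_pullback\<close> selects one by
  choice.\<close>

lemma pullback_has_derivative:
  assumes u: "\<And>x. x \<in> {0..1} \<Longrightarrow> u (\<phi> x) = V x"
    and V: "AE x in circle_measure. (V has_real_derivative v x) (at x within {0..1})"
  shows "AE x in circle_measure. (u has_real_derivative v x / g x) (at (\<phi> x) within {0..1})"
  using V \<phi>_has_derivative g_lower AE_circle_interior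
proof eventually_elim
  case (elim x)
  have x: "x \<in> interior {0..1}" "0 < x" "x < 1"
    using elim by (auto simp: interior_atLeastAtMost_real)
  have y: "0 < \<phi> x" "\<phi> x < 1"
    using \<phi>_less[of 0 x] \<phi>_less[of x 1] x by (auto simp: \<phi>_0 \<phi>_1)
  have \<psi>x: "\<psi> (\<phi> x) = x"
    using x by (simp add: \<psi>_\<phi>)
  have at_x: "at x within {0..1} = at x"
    using x(1) by (rule at_within_interior)
  have "DERIV \<phi> (\<psi> (\<phi> x)) :> g x"
    using elim(2) by (simp only: \<psi>x at_x)
  then have "DERIV \<psi> (\<phi> x) :> inverse (g x)"
  proof (rule DERIV_inverse_function)
    show "g x \<noteq> 0"
      using elim(3) k_pos by simp
    show "0 < \<phi> x" "\<phi> x < 1"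
      by (fact y)+
    show "\<phi> (\<psi> z) = z" if "0 < z" "z < 1" for z
      using that by (simp add: \<phi>_\<psi>)
    show "isCont \<psi> (\<phi> x)"
      using \<psi>_continuous by (simp add: continuous_on_eq_continuous_at)
  qed
  moreover have "DERIV V (\<psi> (\<phi> x)) :> v x"
    using elim(1) by (simp only: \<psi>x at_x)
  ultimately have "DERIV (\<lambda>z. V (\<psi> z)) (\<phi> x) :> v x * inverse (g x)"
    by (rule DERIV_chain2[rotated])
  then have "((\<lambda>z. V (\<psi> z)) has_real_derivative v x / g x) (at (\<phi> x) within {0..1})"
    by (simp add: divide_inverse has_field_derivative_at_within)
  then show ?case
    by (rule has_real_derivative_transform_on[rotated 2]) (use y u \<psi>_in in \<open>auto simp: \<phi>_\<psi> u[symmetric]\<close>)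
qed

lemma pullback_L2:
  assumes r: "r \<in> borel_measurable circle_measure"
    and int: "integrable circle_measure (\<lambda>x. g x * (r x)\<^sup>2)"
  shows "(\<lambda>y. r (\<psi> y)) \<in> L2"
proof -
  have m: "(\<lambda>y. r (\<psi> y)) \<in> borel_measurable circle_measure"
    by (rule compose_\<psi>_measurable[OF r])
  have "integrable circle_measure (\<lambda>x. g x * (r (\<psi> (\<phi> x)))\<^sup>2)"
    by (rule Bochner_Integration.integrable_cong[THEN iffD1, OF refl _ int]) (simp add: \<psi>_\<phi>)
  then have "integrable circle_measure (\<lambda>y. (r (\<psi> y))\<^sup>2)"
    using m by (subst change_of_variables(1)) auto
  then show ?thesis
    using m by (simp add: L2_def)
qed

text \<open>Substitution turns the integral of the squared derivative into that of
  \<open>(v x)\<^sup>2 / g x\<close>. Absolute continuity passes through the Lipschitz inverse, and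
  the boundary values persist because \<open>\<psi>\<close> fixes 0 and 1.\<close>

lemma pullback_H1_0:
  assumes V: "abs_continuous V" "V 0 = 0" "V 1 = 0"
    and der: "AE x in circle_measure. (V has_real_derivative v x) (at x within {0..1})"
    and v: "v \<in> borel_measurable circle_measure"
    and int: "integrable circle_measure (\<lambda>x. (v x)\<^sup>2 / g x)"
  shows "(\<lambda>y. V (\<psi> y)) \<in> H1_0"
proof -
  have \<psi>01: "\<psi> 0 = 0" "\<psi> 1 = 1"
    using \<psi>_\<phi>[of 0] \<psi>_\<phi>[of 1] by (simp_all add: \<phi>_0 \<phi>_1)
  have gpos: "AE x in circle_measure. 0 < g x"
    using g_lower by eventually_elim (use k_pos in simp)
  have "0 < 1 / k"
    using k_pos by simp
  then have "abs_continuous (\<lambda>y. V (\<psi> y))"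
    by (rule abs_continuous_compose_Lipschitz[OF V(1) _ \<psi>_in \<psi>_strict_mono \<psi>_Lipschitz])
  moreover have "AE x in circle_measure. ((\<lambda>y. V (\<psi> y)) has_real_derivative v x / g x) (at (\<phi> x) within {0..1})"
    by (rule pullback_has_derivative[OF _ der]) (simp add: \<psi>_\<phi>)
  then have "AE y in circle_measure.
      ((\<lambda>y. V (\<psi> y)) has_real_derivative v (\<psi> y) / g (\<psi> y)) (at (\<phi> (\<psi> y)) within {0..1})"
    by (rule AE_compose_\<psi>)
  then have d: "AE y in circle_measure.
      y \<in> {0..1} \<longrightarrow> ((\<lambda>y. V (\<psi> y)) has_real_derivative v (\<psi> y) / g (\<psi> y)) (at y within {0..1})"
    by eventually_elim (use \<phi>_\<psi> in auto)
  have "AE x in circle_measure. x \<in> {0..1}"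
    by (simp add: AE_restrict_space_iff)
  with d have "AE y in circle_measure. (\<lambda>y. V (\<psi> y)) differentiable (at y within {0..1})"
    by eventually_elim (auto simp: real_differentiable_def)
  moreover have "xderiv (\<lambda>y. V (\<psi> y)) \<in> L2"
  proof -
    have "AE x in circle_measure. (v x)\<^sup>2 / g x = g x * (v x / g x)\<^sup>2"
      using gpos by eventually_elim (simp add: power2_eq_square)
    then have "integrable circle_measure (\<lambda>x. g x * (v x / g x)\<^sup>2)"
      using int v by (subst integrable_cong_AE[symmetric]) (auto intro!: borel_measurable_times borel_measurable_power borel_measurable_divide)
    then have L: "(\<lambda>y. v (\<psi> y) / g (\<psi> y)) \<in> L2"
      using v by (intro pullback_L2[of "\<lambda>x. v x / g x"]) auto
    have eq: "AE y in circle_measure. v (\<psi> y) / g (\<psi> y) = xderiv (\<lambda>y. V (\<psi> y)) y"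
      using d \<open>AE x in circle_measure. x \<in> {0..1}\<close> by eventually_elim (simp add: xderiv_eqI)
    have m: "xderiv (\<lambda>y. V (\<psi> y)) \<in> borel_measurable circle_measure"
      using L by (intro borel_measurable_lebesgue_on_AE[OF _ _ eq]) (auto simp: L2_def)
    have "integrable circle_measure (\<lambda>y. (xderiv (\<lambda>y. V (\<psi> y)) y)\<^sup>2)"
      using L m eq by (subst integrable_cong_AE[where g="\<lambda>y. (v (\<psi> y) / g (\<psi> y))\<^sup>2"])
        (auto simp: L2_def elim!: eventually_mono)
    with m show ?thesis
      by (simp add: L2_def)
  qed
  ultimately show ?thesis
    using V by (simp add: H1_0_def \<psi>01)
qed

end

section \<open>The geodesic\<close>

lemma at_within_atLeast_neq_bot:
  fixes t :: real
  assumes "0 \<le> t"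
  shows "at t within {0..} \<noteq> bot"
proof
  assume "at t within {0..} = bot"
  moreover have "at_right t \<le> at t within {0..}"
    using assms by (intro at_le) auto
  ultimately show False
    using trivial_limit_at_right_real[of t] by (simp add: bot_unique)
qed

lemma tderiv_eqI:
  assumes "((\<lambda>s. F s x) has_real_derivative D) (at t within {0..})" "0 \<le> t"
  shows "tderiv F t x = D"
  unfolding tderiv_def
  by (rule vector_derivative_within[OF at_within_atLeast_neq_bot[OF assms(2)]])
    (use assms(1) in \<open>simp add: has_real_derivative_iff_has_vector_derivative\<close>)

lemma integrable_circle_const: "integrable circle_measure (\<lambda>x. c :: real)"
  by (intro finite_measure.integrable_const finite_measure_lebesgue_on) simp

lemma L2_integrable:
  assumes "f \<in> L2"
  shows "integrable circle_measure f"
proof (rule Bochner_Integration.integrable_bound)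
  show "integrable circle_measure (\<lambda>x. (f x)\<^sup>2 + 1)"
    using assms integrable_circle_const by (intro Bochner_Integration.integrable_add) (simp add: L2_def)
  have "\<bar>z\<bar> \<le> z\<^sup>2 + 1" for z :: real
  proof -
    have "0 \<le> (\<bar>z\<bar> - 1)\<^sup>2"
      by simp
    then have "2 * \<bar>z\<bar> \<le> z\<^sup>2 + 1"
      by (simp add: power2_diff)
    then show ?thesis
      by simp
  qed
  then show "AE x in circle_measure. norm (f x) \<le> norm ((f x)\<^sup>2 + 1)"
    by simp
qed (use assms in \<open>simp add: L2_def\<close>)

text \<open>The hypotheses on the initial velocity after halving: \<open>a_mean\<close> encodes the
  periodicity of \<open>u0\<close>, \<open>energy\<close> is condition (A) and \<open>bound\<close>
  is condition (B).\<close>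

locale geodesic_data =
  fixes a b :: "real \<Rightarrow> real"
  assumes a_measurable [measurable]: "a \<in> borel_measurable circle_measure"
    and b_measurable [measurable]: "b \<in> borel_measurable circle_measure"
    and a_square: "integrable circle_measure (\<lambda>x. (a x)\<^sup>2)"
    and b_square: "integrable circle_measure (\<lambda>x. (b x)\<^sup>2)"
    and a_mean: "(LINT x|circle_measure. a x) = 0"
    and energy: "(LINT x|circle_measure. (a x)\<^sup>2 - (b x)\<^sup>2) = -1"
    and bound: "AE x in circle_measure. \<bar>b x\<bar> \<le> a x + 1"
begin

lemma a_integrable: "integrable circle_measure a"
  by (rule L2_integrable) (simp add: L2_def a_square)

text \<open>The spatial derivatives of \<open>\<phi>\<close> and of its first two time derivatives,
  as well as the energy density, lie in the span of 1, \<open>a\<close> and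
  \<open>a\<^sup>2 - b\<^sup>2\<close>, with coefficients depending on \<open>t\<close> alone. Time
  derivatives thus act on three coefficients, and no differentiation under the integral sign is
  required.\<close>

definition lin :: "real \<Rightarrow> real \<Rightarrow> real \<Rightarrow> real \<Rightarrow> real" where
  "lin p q r x = p + q * a x + r * ((a x)\<^sup>2 - (b x)\<^sup>2)"

definition Lin :: "real \<Rightarrow> real \<Rightarrow> real \<Rightarrow> real \<Rightarrow> real" where
  "Lin p q r x = (LINT y|lebesgue_on {0..x}. lin p q r y)"

definition A :: "real \<Rightarrow> real" where
  "A x = (LINT y|lebesgue_on {0..x}. a y)"

definition D :: "real \<Rightarrow> real" where
  "D x = (LINT y|lebesgue_on {0..x}. (a y)\<^sup>2 - (b y)\<^sup>2)"

lemma square_diff_integrable: "integrable circle_measure (\<lambda>x. (a x)\<^sup>2 - (b x)\<^sup>2)"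
  using a_square b_square by (rule Bochner_Integration.integrable_diff)

lemma lin_integrable: "integrable circle_measure (lin p q r)"
proof -
  have "integrable circle_measure (\<lambda>x. p + q * a x)"
    by (rule Bochner_Integration.integrable_add[OF integrable_circle_const integrable_mult_right[OF a_integrable]])
  then have "integrable circle_measure (\<lambda>x. p + q * a x + r * ((a x)\<^sup>2 - (b x)\<^sup>2))"
    by (rule Bochner_Integration.integrable_add[OF _ integrable_mult_right[OF square_diff_integrable]])
  then show ?thesis
    unfolding lin_def[abs_def] .
qed

lemma Lin_eq:
  assumes "x \<in> {0..1}"
  shows "Lin p q r x = p * x + q * A x + r * D x"
proof -
  have sub: "integrable (lebesgue_on {0..x}) f" if "integrable circle_measure f" for f :: "real \<Rightarrow> real"
    using assms by (intro integrable_circle_subinterval[OF that]) simp_all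
  note i = sub[OF integrable_circle_const[of p]] sub[OF integrable_mult_right[OF a_integrable, of q]]
    sub[OF integrable_mult_right[OF square_diff_integrable, of r]]
  have "Lin p q r x = (LINT y|lebesgue_on {0..x}. p) + (LINT y|lebesgue_on {0..x}. q * a y)
      + (LINT y|lebesgue_on {0..x}. r * ((a y)\<^sup>2 - (b y)\<^sup>2))"
    unfolding Lin_def lin_def
    by (simp only: Bochner_Integration.integral_add[OF Bochner_Integration.integrable_add[OF i(1,2)] i(3)]
        Bochner_Integration.integral_add[OF i(1,2)])
  also have "(LINT y|lebesgue_on {0..x}. p) = p * x"
    using assms by (simp add: measure_restrict_space)
  also have "(LINT y|lebesgue_on {0..x}. q * a y) = q * A x"
    unfolding A_def by (rule integral_mult_right_zero)
  also have "(LINT y|lebesgue_on {0..x}. r * ((a y)\<^sup>2 - (b y)\<^sup>2)) = r * D x"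
    unfolding D_def by (rule integral_mult_right_zero)
  finally show ?thesis .
qed

lemma Lin_0: "Lin p q r 0 = 0"
proof -
  have "{0::real} \<in> null_sets lebesgue"
    by (simp add: negligible_iff_null_sets[symmetric])
  then show ?thesis
    unfolding Lin_def using integral_eq_zero_null_sets[of "{0}" "lin p q r"]
    by (simp del: insert_null_sets_lebesgue_on_iff)
qed

text \<open>Mean zero removes \<open>q\<close>, and the energy turns \<open>r\<close> into
  \<open>- r\<close>. This one evaluation yields the normalisation of \<open>\<phi>\<close>, the
  periodicity of the velocity and the conserved energy.\<close>

lemma Lin_1: "Lin p q r 1 = p - r"
  using Lin_eq[of 1 p q r] by (simp add: A_def D_def a_mean energy)

lemma Lin_abs_continuous: "abs_continuous (Lin p q r)"
  by (rule abs_continuous_integral[OF lin_integrable[of p q r]])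
    (simp add: Lin_def integral_circle_diff[OF lin_integrable])

text \<open>The exceptional null set does not depend on \<open>t\<close>, since only the coefficients of \<^const>\<open>Lin\<close> do.\<close>

definition good :: "real \<Rightarrow> bool" where
  "good x \<longleftrightarrow> 0 < x \<and> x < 1 \<and> \<bar>b x\<bar> \<le> a x + 1 \<and>
     (\<forall>p q r. (Lin p q r has_real_derivative lin p q r x) (at x within {0..1}))"

lemma AE_good: "AE x in circle_measure. good x"
  using AE_circle_interior bound lebesgue_differentiation[OF a_integrable]
    lebesgue_differentiation[OF square_diff_integrable]
proof eventually_elim
  case (elim x)
  have AD: "(A has_real_derivative a x) (at x within {0..1})"
    "(D has_real_derivative (a x)\<^sup>2 - (b x)\<^sup>2) (at x within {0..1})"
    using elim(3,4) unfolding A_def[abs_def] D_def[abs_def] .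
  have "(Lin p q r has_real_derivative lin p q r x) (at x within {0..1})" for p q r
  proof (rule has_real_derivative_transform_on)
    show "((\<lambda>x. p * x + q * A x + r * D x) has_real_derivative lin p q r x) (at x within {0..1})"
      unfolding lin_def by (auto intro!: derivative_eq_intros AD)
    show "x \<in> {0..1}"
      using elim by simp
  qed (rule Lin_eq)
  then show ?case
    using elim unfolding good_def by blast
qed

section \<open>The factors \<open>f1 + f2\<close> and \<open>f1 - f2\<close> and their
  Wronskian\<close>

definition P :: "real \<Rightarrow> real \<Rightarrow> real" where "P t x = cosh t + (a x + b x) * sinh t"
definition Q :: "real \<Rightarrow> real \<Rightarrow> real" where "Q t x = cosh t + (a x - b x) * sinh t"
definition P' :: "real \<Rightarrow> real \<Rightarrow> real" where "P' t x = sinh t + (a x + b x) * cosh t"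
definition Q' :: "real \<Rightarrow> real \<Rightarrow> real" where "Q' t x = sinh t + (a x - b x) * cosh t"
text \<open>\<open>G\<close> will be the spatial derivative of \<open>\<phi>\<close>, and
  \<open>V\<close> that of its time derivative.\<close>

definition G :: "real \<Rightarrow> real \<Rightarrow> real" where "G t x = P t x * Q t x"
definition V :: "real \<Rightarrow> real \<Rightarrow> real" where "V t x = P' t x * Q t x + P t x * Q' t x"

lemma P_deriv [derivative_intros]: "((\<lambda>t. P t x) has_real_derivative P' t x) (at t within S)"
  and Q_deriv [derivative_intros]: "((\<lambda>t. Q t x) has_real_derivative Q' t x) (at t within S)"
  unfolding P_def Q_def P'_def Q'_def by (rule derivative_eq_intros refl | simp)+

lemma G_deriv: "((\<lambda>t. G t x) has_real_derivative V t x) (at t within S)"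
  unfolding G_def V_def by (auto intro!: derivative_eq_intros)

lemma G_lin: "G t = lin ((cosh t)\<^sup>2) (2 * sinh t * cosh t) ((sinh t)\<^sup>2)"
  by (simp add: fun_eq_iff G_def lin_def P_def Q_def algebra_simps power2_eq_square)

lemma V_lin: "V t = lin (2 * sinh t * cosh t) (2 * ((cosh t)\<^sup>2 + (sinh t)\<^sup>2)) (2 * sinh t * cosh t)"
  by (simp add: fun_eq_iff V_def lin_def P_def Q_def P'_def Q'_def algebra_simps power2_eq_square)

lemma P'Q'_lin: "P' t x * Q' t x = lin ((sinh t)\<^sup>2) (2 * sinh t * cosh t) ((cosh t)\<^sup>2) x"
  by (simp add: lin_def P'_def Q'_def algebra_simps power2_eq_square)

text \<open>Both factors solve \<open>y'' = y\<close> in time, so the expression is constant in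
  \<open>t\<close>. At \<open>t = 0\<close> it is \<open>(a + b) - (a - b)\<close>.\<close>

lemma wronskian: "P' t x * Q t x - P t x * Q' t x = 2 * b x"
proof -
  have "P' t x * Q t x - P t x * Q' t x = 2 * b x * ((cosh t)\<^sup>2 - (sinh t)\<^sup>2)"
    by (simp add: P_def Q_def P'_def Q'_def algebra_simps power2_eq_square)
  then show ?thesis
    by (simp add: hyperbolic_pythagoras)
qed

text \<open>The square of a sum is the square of the difference plus four times the product, applied
  to the two summands of \<open>V\<close>. The difference is the Wronskian.\<close>

lemma V_square: "(V t x)\<^sup>2 = 4 * (b x)\<^sup>2 + 4 * (P' t x * Q' t x) * G t x"
proof -
  have "(V t x)\<^sup>2 = (P' t x * Q t x - P t x * Q' t x)\<^sup>2 + 4 * (P' t x * Q' t x) * G t x"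
    unfolding V_def G_def by (simp add: algebra_simps power2_eq_square)
  then show ?thesis
    by (simp add: wronskian power_mult_distrib)
qed

text \<open>Since \<open>exp (- t) = cosh t - sinh t\<close>, the differences are
  \<open>(1 + a \<plusminus> b) * sinh t\<close>, nonnegative by condition (B).\<close>

lemma good_PQ:
  assumes "good x" "0 \<le> t"
  shows "exp (- t) \<le> P t x" "exp (- t) \<le> Q t x"
proof -
  have "0 \<le> (1 + a x + b x) * sinh t" "0 \<le> (1 + a x - b x) * sinh t"
    using assms by (auto simp: good_def intro!: mult_nonneg_nonneg)
  then show "exp (- t) \<le> P t x" "exp (- t) \<le> Q t x"
    unfolding P_def Q_def cosh_minus_sinh[symmetric] by (simp_all add: algebra_simps)
qed

lemma good_PQ_pos:
  assumes "good x" "0 \<le> t"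
  shows "0 < P t x" "0 < Q t x"
  using good_PQ[OF assms] exp_gt_zero[of "- t"] by linarith+

lemma good_G:
  assumes "good x" "0 \<le> t"
  shows "exp (- 2 * t) \<le> G t x"
proof -
  have "exp (- 2 * t) = exp (- t) * exp (- t)"
    by (simp add: exp_add[symmetric])
  also have "\<dots> \<le> G t x"
    unfolding G_def using good_PQ[OF assms] good_PQ_pos[OF assms] by (intro mult_mono) auto
  finally show ?thesis .
qed

lemma good_G_pos: "good x \<Longrightarrow> 0 \<le> t \<Longrightarrow> 0 < G t x"
  using good_PQ_pos by (simp add: G_def)

section \<open>The flow and its time derivatives\<close>

definition \<phi> :: "real \<Rightarrow> real \<Rightarrow> real" where
  "\<phi> t x = (LINT y|lebesgue_on {0..x}. G t y)"

definition \<alpha> :: "real \<Rightarrow> real \<Rightarrow> real" where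
  "\<alpha> t x = 2 * artanh (b x * sinh t / (cosh t + a x * sinh t))"

lemma \<phi>_Lin: "\<phi> t = Lin ((cosh t)\<^sup>2) (2 * sinh t * cosh t) ((sinh t)\<^sup>2)"
  by (simp add: fun_eq_iff \<phi>_def Lin_def G_lin)

lemma homeomorphism:
  assumes "0 \<le> t"
  shows "circle_homeomorphism (\<phi> t) (G t) (exp (- 2 * t))"
proof
  show "integrable circle_measure (G t)"
    unfolding G_lin by (rule lin_integrable)
  show "AE x in circle_measure. exp (- 2 * t) \<le> G t x"
    using AE_good by eventually_elim (rule good_G[OF _ assms])
  show "\<phi> t x = (LINT y|lebesgue_on {0..x}. G t y)" for x
    by (rule \<phi>_def)
  show "\<phi> t 1 = 1"
    by (simp add: \<phi>_Lin Lin_1 hyperbolic_pythagoras)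
qed simp

lemma good_\<phi>_deriv: "good x \<Longrightarrow> (\<phi> t has_real_derivative G t x) (at x within {0..1})"
  unfolding \<phi>_Lin G_lin by (simp add: good_def)

text \<open>The coefficients are the time derivatives of those in \<open>\<phi>_Lin\<close>;
  \<open>Dtt\<phi>\<close> differentiates once more.\<close>

definition Dt\<phi> :: "real \<Rightarrow> real \<Rightarrow> real" where
  "Dt\<phi> t = Lin (2 * sinh t * cosh t) (2 * ((cosh t)\<^sup>2 + (sinh t)\<^sup>2)) (2 * sinh t * cosh t)"

definition Dtt\<phi> :: "real \<Rightarrow> real \<Rightarrow> real" where
  "Dtt\<phi> t = Lin (2 * ((cosh t)\<^sup>2 + (sinh t)\<^sup>2)) (8 * sinh t * cosh t) (2 * ((cosh t)\<^sup>2 + (sinh t)\<^sup>2))"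

lemma \<phi>_tderiv:
  assumes "x \<in> {0..1}"
  shows "((\<lambda>s. \<phi> s x) has_real_derivative Dt\<phi> t x) (at t within S)"
  unfolding \<phi>_Lin Dt\<phi>_def Lin_eq[OF assms]
  by (auto intro!: derivative_eq_intros simp: algebra_simps power2_eq_square)

lemma Dt\<phi>_tderiv:
  assumes "x \<in> {0..1}"
  shows "((\<lambda>s. Dt\<phi> s x) has_real_derivative Dtt\<phi> t x) (at t within S)"
  unfolding Dtt\<phi>_def Dt\<phi>_def Lin_eq[OF assms]
  by (auto intro!: derivative_eq_intros simp: algebra_simps power2_eq_square)

lemma good_Dt\<phi>_deriv: "good x \<Longrightarrow> (Dt\<phi> t has_real_derivative V t x) (at x within {0..1})"
  unfolding Dt\<phi>_def V_lin by (simp add: good_def)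

lemma tderiv_\<phi>: "x \<in> {0..1} \<Longrightarrow> 0 \<le> t \<Longrightarrow> tderiv \<phi> t x = Dt\<phi> t x"
  by (rule tderiv_eqI[OF \<phi>_tderiv])

lemma tderiv_\<phi>_has_tderiv:
  assumes "x \<in> {0..1}" "0 \<le> t"
  shows "((\<lambda>s. tderiv \<phi> s x) has_real_derivative Dtt\<phi> t x) (at t within {0..})"
  by (rule has_real_derivative_transform_on[OF _ _ Dt\<phi>_tderiv[OF assms(1)]])
    (use assms in \<open>simp_all add: tderiv_\<phi>\<close>)

lemma tderiv_tderiv_\<phi>: "x \<in> {0..1} \<Longrightarrow> 0 \<le> t \<Longrightarrow> tderiv (tderiv \<phi>) t x = Dtt\<phi> t x"
  by (rule tderiv_eqI[OF tderiv_\<phi>_has_tderiv])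

text \<open>In the logarithmic form of \<open>artanh\<close> the common denominator
  \<open>f1\<close> cancels, which leaves the quotient of \<open>f1 + f2\<close> and
  \<open>f1 - f2\<close>.\<close>

lemma \<alpha>_ln:
  assumes "good x" "0 \<le> t"
  shows "\<alpha> t x = ln (P t x) - ln (Q t x)"
proof -
  let ?c = "cosh t + a x * sinh t"
  have PQ: "P t x = ?c + b x * sinh t" "Q t x = ?c - b x * sinh t"
    by (simp_all add: P_def Q_def algebra_simps)
  note pos = good_PQ_pos[OF assms]
  \<comment> \<open>\<open>?c\<close> is the mean of \<open>P t x\<close> and
    \<open>Q t x\<close>.\<close>
  have c: "0 < ?c"
    using pos unfolding PQ by linarith
  have "1 + z / ?c = (?c + z) / ?c" "1 - z / ?c = (?c - z) / ?c" for z
    using c by (simp_all add: add_divide_distrib diff_divide_distrib)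
  then have "(1 + b x * sinh t / ?c) / (1 - b x * sinh t / ?c) = P t x / Q t x"
    using c unfolding PQ by simp
  then show ?thesis
    using pos by (simp add: \<alpha>_def artanh_def ln_div)
qed

lemma ln_PQ_deriv:
  assumes "good x" "0 \<le> t"
  shows "((\<lambda>s. ln (P s x) - ln (Q s x)) has_real_derivative 2 * b x / G t x) (at t within S)"
proof -
  note pos = good_PQ_pos[OF assms]
  have "((\<lambda>s. ln (P s x) - ln (Q s x)) has_real_derivative P' t x / P t x - Q' t x / Q t x) (at t within S)"
    using pos by (auto intro!: derivative_eq_intros)
  also have "P' t x / P t x - Q' t x / Q t x = (P' t x * Q t x - P t x * Q' t x) / G t x"
    using pos by (simp add: G_def field_simps)
  finally show ?thesis
    by (simp add: wronskian)
qed

lemma \<alpha>_has_tderiv: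
  assumes "good x" "0 \<le> t"
  shows "((\<lambda>s. \<alpha> s x) has_real_derivative 2 * b x / G t x) (at t within {0..})"
  by (rule has_real_derivative_transform_on[OF _ _ ln_PQ_deriv[OF assms]])
    (use assms in \<open>simp_all add: \<alpha>_ln\<close>)

lemma tderiv_\<alpha>: "good x \<Longrightarrow> 0 \<le> t \<Longrightarrow> tderiv \<alpha> t x = 2 * b x / G t x"
  by (rule tderiv_eqI[OF \<alpha>_has_tderiv])

lemma tderiv_\<alpha>_has_tderiv:
  assumes "good x" "0 \<le> t"
  shows "((\<lambda>s. tderiv \<alpha> s x) has_real_derivative - (2 * b x * V t x / (G t x)\<^sup>2)) (at t within {0..})"
proof (rule has_real_derivative_transform_on)
  show "((\<lambda>s. 2 * b x / G s x) has_real_derivative - (2 * b x * V t x / (G t x)\<^sup>2)) (at t within {0..})"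
    using good_G_pos[OF assms] by (auto intro!: derivative_eq_intros G_deriv simp: power2_eq_square)
qed (use assms in \<open>simp_all add: tderiv_\<alpha>\<close>)

lemma tderiv_tderiv_\<alpha>:
  "good x \<Longrightarrow> 0 \<le> t \<Longrightarrow> tderiv (tderiv \<alpha>) t x = - (2 * b x * V t x / (G t x)\<^sup>2)"
  by (rule tderiv_eqI[OF tderiv_\<alpha>_has_tderiv])

text \<open>For fixed \<open>x\<close> the fundamental theorem of calculus in time applies, with
  \<open>\<alpha> 0 x = 0\<close>. Continuity and positivity of \<open>G\<close> in time make the
  integrand integrable.\<close>

lemma \<alpha>_integral:
  assumes "good x" "0 \<le> t"
  shows "integrable (lebesgue_on {0..t}) (\<lambda>s. 1 / xderiv (\<phi> s) x)"
    and "\<alpha> t x = 2 * b x * (LINT s|lebesgue_on {0..t}. 1 / xderiv (\<phi> s) x)"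
proof -
  have eq: "1 / xderiv (\<phi> s) x = 1 / G s x" for s
    using assms(1) by (subst xderiv_eqI[OF good_\<phi>_deriv]) (auto simp: good_def)
  have "continuous_on {0..t} (\<lambda>s. G s x)"
    by (rule DERIV_continuous_on[OF G_deriv])
  then have "continuous_on {0..t} (\<lambda>s. 1 / G s x)"
    using good_G_pos[OF assms(1)] by (intro continuous_intros) force+
  then have int: "integrable (lebesgue_on {0..t}) (\<lambda>s. 1 / G s x)"
    by (rule continuous_imp_integrable_real)
  then show "integrable (lebesgue_on {0..t}) (\<lambda>s. 1 / xderiv (\<phi> s) x)"
    unfolding eq .
  have "((\<lambda>s. 2 * b x / G s x) has_integral (\<alpha> t x - \<alpha> 0 x)) {0..t}"
  proof (rule fundamental_theorem_of_calculus[OF assms(2)])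
    fix s assume "s \<in> {0..t}"
    then show "((\<lambda>s. \<alpha> s x) has_vector_derivative 2 * b x / G s x) (at s within {0..t})"
      unfolding has_real_derivative_iff_has_vector_derivative[symmetric]
      by (intro DERIV_subset[OF \<alpha>_has_tderiv[OF assms(1)]]) auto
  qed
  moreover have "((\<lambda>s. 2 * b x * (1 / G s x)) has_integral
      (2 * b x * (LINT s|lebesgue_on {0..t}. 1 / G s x))) {0..t}"
    by (intro has_integral_mult_right has_integral_integral_lebesgue_on int) simp
  ultimately show "\<alpha> t x = 2 * b x * (LINT s|lebesgue_on {0..t}. 1 / xderiv (\<phi> s) x)"
    unfolding eq by (simp add: has_integral_unique \<alpha>_def)
qed

text \<open>Each logarithm is bounded by \<open>t\<close> plus its argument, and in
  \<open>P + Q\<close> the contribution of \<open>b\<close> cancels. Hence \<open>\<alpha>\<close>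
  is dominated by an affine function of \<open>a\<close>.\<close>

lemma \<alpha>_L2:
  assumes t: "0 \<le> t"
  shows "\<alpha> t \<in> L2"
proof -
  have m: "\<alpha> t \<in> borel_measurable circle_measure"
    unfolding \<alpha>_def[abs_def] artanh_def by measurable
  have "integrable circle_measure (\<lambda>x. (\<alpha> t x)\<^sup>2)"
  proof (rule Bochner_Integration.integrable_bound)
    show "integrable circle_measure (\<lambda>x. 2 * (2 * t + 2 * cosh t)\<^sup>2 + 8 * (sinh t)\<^sup>2 * (a x)\<^sup>2)"
      by (intro Bochner_Integration.integrable_add integrable_mult_right integrable_circle_const a_square)
    show "AE x in circle_measure. norm ((\<alpha> t x)\<^sup>2)
        \<le> norm (2 * (2 * t + 2 * cosh t)\<^sup>2 + 8 * (sinh t)\<^sup>2 * (a x)\<^sup>2)"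
      using AE_good
    proof eventually_elim
      case (elim x)
      \<comment> \<open>The lower bound on \<open>z\<close> controls a negative logarithm, and
        \<open>ln z \<le> z - 1\<close> a positive one.\<close>
      have ln_bound: "\<bar>ln z\<bar> \<le> t + z" if "exp (- t) \<le> z" for z
      proof -
        have z: "0 < z"
          using that exp_gt_zero[of "- t"] by linarith
        then have "- t \<le> ln z"
          using that by (simp add: ln_ge_iff)
        then show ?thesis
          using ln_le_minus_one[OF z] z t by (simp add: abs_le_iff)
      qed
      have square_sum: "(x + y)\<^sup>2 \<le> 2 * x\<^sup>2 + 2 * y\<^sup>2" for x y :: real
        using zero_le_power2[of "x - y"] by (simp add: power2_sum power2_diff)
      let ?x = "2 * t + 2 * cosh t" and ?y = "2 * (a x * sinh t)"
      have "\<bar>\<alpha> t x\<bar> \<le> (t + P t x) + (t + Q t x)"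
        unfolding \<alpha>_ln[OF elim t]
        using ln_bound[OF good_PQ(1)[OF elim t]] ln_bound[OF good_PQ(2)[OF elim t]] by linarith
      also have "\<dots> = ?x + ?y"
        by (simp add: P_def Q_def algebra_simps)
      finally have "\<bar>\<alpha> t x\<bar>\<^sup>2 \<le> (?x + ?y)\<^sup>2"
        by (intro power_mono) auto
      also have "\<dots> \<le> 2 * ?x\<^sup>2 + 2 * ?y\<^sup>2"
        by (rule square_sum)
      finally show ?case
        by (simp add: power_mult_distrib algebra_simps)
    qed
  qed (use m in simp)
  with m show ?thesis
    by (simp add: L2_def)
qed

section \<open>Square integrability of the velocity\<close>

lemma G_measurable [measurable]: "G t \<in> borel_measurable circle_measure"
  and V_measurable [measurable]: "V t \<in> borel_measurable circle_measure"
  unfolding G_lin V_lin using borel_measurable_integrable[OF lin_integrable] by auto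

lemma b_square_over_G_integrable:
  assumes t: "0 \<le> t"
  shows "integrable circle_measure (\<lambda>x. 4 * (b x)\<^sup>2 / G t x)"
proof (rule Bochner_Integration.integrable_bound)
  show "integrable circle_measure (\<lambda>x. 4 * exp (2 * t) * (b x)\<^sup>2)"
    by (intro integrable_mult_right b_square)
  show "AE x in circle_measure. norm (4 * (b x)\<^sup>2 / G t x) \<le> norm (4 * exp (2 * t) * (b x)\<^sup>2)"
    using AE_good
  proof eventually_elim
    case (elim x)
    have "4 * (b x)\<^sup>2 / G t x \<le> 4 * (b x)\<^sup>2 / exp (- 2 * t)"
      using good_G[OF elim t] by (intro divide_left_mono) (auto simp: good_G_pos[OF elim t])
    then show ?case
      using good_G_pos[OF elim t] by (simp add: exp_minus divide_inverse mult_ac)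
  qed
qed measurable

text \<open>The first term on the right is the square of the time derivative of
  \<open>\<alpha>\<close> weighted by \<open>G\<close>. Moving it to the left leaves four times the
  energy density, the form in which the metric and the Christoffel operator use this
  identity.\<close>

lemma V_square_over_G: "good x \<Longrightarrow> 0 \<le> t \<Longrightarrow>
    (V t x)\<^sup>2 / G t x = 4 * (b x)\<^sup>2 / G t x + 4 * lin ((sinh t)\<^sup>2) (2 * sinh t * cosh t) ((cosh t)\<^sup>2) x"
  using good_G_pos[of x t] by (simp add: V_square P'Q'_lin add_divide_distrib)

lemma V_square_over_G_integrable:
  assumes t: "0 \<le> t"
  shows "integrable circle_measure (\<lambda>x. (V t x)\<^sup>2 / G t x)"
proof (rule integrable_cong_AE_imp)
  show "integrable circle_measure
      (\<lambda>x. 4 * (b x)\<^sup>2 / G t x + 4 * lin ((sinh t)\<^sup>2) (2 * sinh t * cosh t) ((cosh t)\<^sup>2) x)"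
    by (intro Bochner_Integration.integrable_add integrable_mult_right lin_integrable
        b_square_over_G_integrable t)
  show "AE x in circle_measure. 4 * (b x)\<^sup>2 / G t x + 4 * lin ((sinh t)\<^sup>2) (2 * sinh t * cosh t) ((cosh t)\<^sup>2) x
      = (V t x)\<^sup>2 / G t x"
    using AE_good by eventually_elim (simp add: V_square_over_G t)
qed measurable

text \<open>The witness is the velocity composed with the inverse homeomorphism. Its two square
  integrals become those of \<open>V\<^sup>2 / G\<close> and \<open>4 b\<^sup>2 / G\<close>.\<close>

lemma velocity_tangent:
  assumes t: "0 \<le> t"
  shows "(tderiv \<phi> t, tderiv \<alpha> t) \<in> T_M_AC (\<phi> t, \<alpha> t)"
proof -
  interpret circle_homeomorphism "\<phi> t" "G t" "exp (- 2 * t)"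
    by (rule homeomorphism[OF t])
  let ?r = "\<lambda>x. 2 * b x / G t x"
  have "(\<lambda>y. Dt\<phi> t (\<psi> y)) \<in> H1_0"
  proof (rule pullback_H1_0)
    \<comment> \<open>The value at 1 vanishes by \<open>Lin_1\<close> because the first and third
      coefficients of \<open>Dt\<phi>\<close> coincide.\<close>
    show "abs_continuous (Dt\<phi> t)" "Dt\<phi> t 0 = 0" "Dt\<phi> t 1 = 0"
      unfolding Dt\<phi>_def by (simp_all add: Lin_abs_continuous Lin_0 Lin_1)
    show "AE x in circle_measure. (Dt\<phi> t has_real_derivative V t x) (at x within {0..1})"
      using AE_good by eventually_elim (rule good_Dt\<phi>_deriv)
  qed (use V_square_over_G_integrable[OF t] in simp_all)
  moreover have "(\<lambda>y. ?r (\<psi> y)) \<in> L2"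
  proof (rule pullback_L2)
    show "integrable circle_measure (\<lambda>x. G t x * (?r x)\<^sup>2)"
    proof (rule integrable_cong_AE_imp[OF b_square_over_G_integrable[OF t]])
      show "AE x in circle_measure. 4 * (b x)\<^sup>2 / G t x = G t x * (?r x)\<^sup>2"
        using AE_good
      proof eventually_elim
        case (elim x)
        show ?case
          using good_G_pos[OF elim t] by (simp add: power2_eq_square)
      qed
    qed measurable
  qed measurable
  moreover have "right_translate (\<phi> t) (\<lambda>y. Dt\<phi> t (\<psi> y), \<lambda>y. ?r (\<psi> y)) (tderiv \<phi> t, tderiv \<alpha> t)"
  proof -
    have "AE x in circle_measure. tderiv \<alpha> t x = ?r (\<psi> (\<phi> t x))"
      using AE_good
    proof eventually_elim
      case (elim x)
      then have "\<psi> (\<phi> t x) = x"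
        by (intro \<psi>_\<phi>) (simp add: good_def)
      then show ?case
        by (simp only: tderiv_\<alpha>[OF elim t])
    qed
    then show ?thesis
      by (simp add: tderiv_\<phi> t \<psi>_\<phi>)
  qed
  ultimately show ?thesis
    unfolding T_M_AC.simps T_id_def by blast
qed

text \<open>At good points \<open>G\<close> is positive, so the flat set is null and the integral
  runs over the whole circle. There the integrand is four times a \<open>lin\<close> whose integral
  is \<open>(sinh t)\<^sup>2 - (cosh t)\<^sup>2\<close>.\<close>

lemma velocity_norm:
  assumes t: "0 \<le> t"
  shows "indef_metric (\<phi> t, \<alpha> t) (tderiv \<phi> t, tderiv \<alpha> t) (tderiv \<phi> t, tderiv \<alpha> t) = -1"
proof -
  let ?U = "tderiv \<phi> t" and ?R = "tderiv \<alpha> t"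
  let ?f = "\<lambda>x. xderiv ?U x * xderiv ?U x / xderiv (\<phi> t) x - ?R x * ?R x * xderiv (\<phi> t) x"
  let ?l = "lin ((sinh t)\<^sup>2) (2 * sinh t * cosh t) ((cosh t)\<^sup>2)"
  have good_f: "x \<notin> flat_set (\<phi> t) \<and> 4 * ?l x = ?f x" if x: "good x" for x
  proof -
    have x01: "x \<in> {0..1}"
      using x by (simp add: good_def)
    have G: "xderiv (\<phi> t) x = G t x"
      by (rule xderiv_eqI[OF good_\<phi>_deriv[OF x] x01])
    have "(?U has_real_derivative V t x) (at x within {0..1})"
      by (rule has_real_derivative_transform_on[OF x01 _ good_Dt\<phi>_deriv[OF x]]) (simp add: tderiv_\<phi> t)
    then have U: "xderiv ?U x = V t x"
      by (rule xderiv_eqI[OF _ x01])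
    note pos = good_G_pos[OF x t]
    have "x \<notin> flat_set (\<phi> t)"
    proof
      assume "x \<in> flat_set (\<phi> t)"
      then have "xderiv (\<phi> t) x = 0"
        using x01 by (intro xderiv_eqI) (simp_all add: flat_set_def)
      then show False
        using G pos by simp
    qed
    moreover have "?f x = (V t x)\<^sup>2 / G t x - 4 * (b x)\<^sup>2 / G t x"
      using pos by (simp add: G U tderiv_\<alpha>[OF x t] power2_eq_square)
    ultimately show ?thesis
      using V_square_over_G[OF x t] by simp
  qed
  have null: "AE x in circle_measure. x \<notin> flat_set (\<phi> t)"
    using AE_good by eventually_elim (use good_f in blast)
  obtain N where N: "\<And>x. x \<in> space circle_measure - N \<Longrightarrow> x \<notin> flat_set (\<phi> t)"
    "N \<in> null_sets circle_measure"
    by (rule AE_E3[OF null]) blast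
  \<comment> \<open>The flat set is contained in a null set, and completeness makes it
    measurable.\<close>
  have flat: "flat_set (\<phi> t) \<in> null_sets lebesgue"
  proof -
    have "N \<in> null_sets lebesgue"
      using N(2) by (simp add: null_sets_restrict_space)
    moreover have "flat_set (\<phi> t) \<subseteq> N"
    proof
      fix x assume x: "x \<in> flat_set (\<phi> t)"
      then have "x \<in> space circle_measure"
        by (simp add: flat_set_def)
      then show "x \<in> N"
        using N(1) x by blast
    qed
    ultimately show ?thesis
      using completion.complete2 by blast
  qed
  have restr: "(LINT x|lebesgue_on ({0..1} - flat_set (\<phi> t)). h x) = (LINT x|circle_measure. h x)"
    if h: "h \<in> borel_measurable circle_measure" for h :: "real \<Rightarrow> real"
  proof -
    let ?S = "{0..1} - flat_set (\<phi> t)"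
    have S: "?S \<in> sets lebesgue"
      using flat by (intro sets.Diff) auto
    have e: "AE x in circle_measure. h x = (if x \<in> ?S then h x else 0)"
      using AE_good by eventually_elim (use good_f in \<open>simp add: good_def\<close>)
    have m: "(\<lambda>x. if x \<in> ?S then h x else 0) \<in> borel_measurable circle_measure"
      by (rule borel_measurable_lebesgue_on_AE[OF h _ e]) simp
    have "(LINT x|lebesgue_on ?S. h x) = (LINT x|circle_measure. (if x \<in> ?S then h x else 0))"
      using S by (intro Lebesgue_Measure.integral_restrict[symmetric]) auto
    also have "\<dots> = (LINT x|circle_measure. h x)"
      by (rule integral_cong_AE[OF h m e, symmetric])
    finally show ?thesis .
  qed
  have ae: "AE x in circle_measure. 4 * ?l x = ?f x"
    using AE_good by eventually_elim (use good_f in blast)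
  have lm: "(\<lambda>x. 4 * ?l x) \<in> borel_measurable circle_measure"
    using borel_measurable_integrable[OF lin_integrable] by simp
  have fm: "?f \<in> borel_measurable circle_measure"
    by (rule borel_measurable_lebesgue_on_AE[OF lm _ ae]) simp
  have "(LINT x|lebesgue_on ({0..1} - flat_set (\<phi> t)). ?f x) = (LINT x|circle_measure. ?f x)"
    by (rule restr[OF fm])
  also have "\<dots> = (LINT x|circle_measure. 4 * ?l x)"
    by (rule integral_cong_AE[OF lm fm ae, symmetric])
  also have "\<dots> = 4 * Lin ((sinh t)\<^sup>2) (2 * sinh t * cosh t) ((cosh t)\<^sup>2) 1"
    unfolding Lin_def by (rule integral_mult_right_zero)
  also have "\<dots> = - 4"
    by (simp add: Lin_1 sinh_square_eq)
  finally show ?thesis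
    by simp
qed

text \<open>Nothing is known about the chosen pullback beyond its defining property. That already
  fixes \<open>xderiv u\<close> and \<open>\<rho>\<close> at \<open>\<phi> t x\<close> for almost
  every \<open>x\<close>, and every integral of \<open>u\<close> and \<open>\<rho>\<close> is
  brought to such points by substitution.\<close>

lemma geodesic_equation:
  assumes t: "0 \<le> t"
  shows "case christoffel (\<phi> t, \<alpha> t) (tderiv \<phi> t, tderiv \<alpha> t) (tderiv \<phi> t, tderiv \<alpha> t)
              of (\<Gamma>1, \<Gamma>2) \<Rightarrow>
        (\<forall>x\<in>{0..1}. tderiv (tderiv \<phi>) t x = \<Gamma>1 x) \<and>
        (AE x in circle_measure. tderiv (tderiv \<alpha>) t x = \<Gamma>2 x)"
proof -
  interpret circle_homeomorphism "\<phi> t" "G t" "exp (- 2 * t)"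
    by (rule homeomorphism[OF t])
  obtain u \<rho> where pb: "right_pullback (\<phi> t) (tderiv \<phi> t, tderiv \<alpha> t) = (u, \<rho>)"
    by (rule prod.exhaust)
  have "\<exists>u\<rho>. u\<rho> \<in> T_id \<and> right_translate (\<phi> t) u\<rho> (tderiv \<phi> t, tderiv \<alpha> t)"
    using velocity_tangent[OF t, unfolded T_M_AC.simps mem_Collect_eq] by blast
  then have "right_pullback (\<phi> t) (tderiv \<phi> t, tderiv \<alpha> t) \<in> T_id \<and>
      right_translate (\<phi> t) (right_pullback (\<phi> t) (tderiv \<phi> t, tderiv \<alpha> t)) (tderiv \<phi> t, tderiv \<alpha> t)"
    unfolding right_pullback_def by (rule someI_ex)
  then have u: "u \<in> H1_0" and \<rho>: "\<rho> \<in> L2"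
    and u\<phi>: "\<And>x. x \<in> {0..1} \<Longrightarrow> u (\<phi> t x) = Dt\<phi> t x"
    and \<rho>\<phi>: "AE x in circle_measure. tderiv \<alpha> t x = \<rho> (\<phi> t x)"
    unfolding pb by (auto simp: T_id_def tderiv_\<phi> t)
  have "AE x in circle_measure. (Dt\<phi> t has_real_derivative V t x) (at x within {0..1})"
    using AE_good by eventually_elim (rule good_Dt\<phi>_deriv)
  from pullback_has_derivative[OF u\<phi> this]
  have "AE x in circle_measure. (u has_real_derivative V t x / G t x) (at (\<phi> t x) within {0..1})" .
  then have pt: "AE x in circle_measure. good x \<and>
      xderiv u (\<phi> t x) = V t x / G t x \<and> \<rho> (\<phi> t x) = 2 * b x / G t x"
    using AE_good \<rho>\<phi>
  proof eventually_elim
    case (elim x)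
    have "\<phi> t x \<in> {0..1}"
      using elim(2) by (intro \<phi>_range) (simp add: good_def)
    then show ?case
      using elim xderiv_eqI[OF elim(1)] by (simp add: tderiv_\<alpha> t)
  qed
  let ?h = "\<lambda>y. xderiv u y * xderiv u y - \<rho> y * \<rho> y"
  let ?l = "lin ((sinh t)\<^sup>2) (2 * sinh t * cosh t) ((cosh t)\<^sup>2)"
  have h: "integrable circle_measure ?h"
    using u \<rho> unfolding power2_eq_square[symmetric]
    by (intro Bochner_Integration.integrable_diff) (simp_all add: H1_0_def L2_def)
  \<comment> \<open>The factor \<open>G\<close> from the substitution cancels one power in each
    denominator, which gives the two terms of \<open>V_square_over_G\<close>.\<close>
  have ae: "AE x in circle_measure. G t x * ?h (\<phi> t x) = 4 * ?l x"
    using pt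
  proof eventually_elim
    case (elim x)
    then have good: "good x" and eqs: "xderiv u (\<phi> t x) = V t x / G t x" "\<rho> (\<phi> t x) = 2 * b x / G t x"
      by auto
    have "G t x * ?h (\<phi> t x) = (V t x)\<^sup>2 / G t x - 4 * (b x)\<^sup>2 / G t x"
      using good_G_pos[OF good t] unfolding eqs by (simp add: power2_eq_square field_simps)
    then show ?case
      using V_square_over_G[OF good t] by simp
  qed
  have hm: "(\<lambda>x. ?h (\<phi> t x)) \<in> borel_measurable circle_measure"
    by (rule compose_\<phi>_measurable) (rule borel_measurable_integrable[OF h])
  have int: "(LINT y|lebesgue_on {0..\<phi> t x}. ?h y)
      = 4 * Lin ((sinh t)\<^sup>2) (2 * sinh t * cosh t) ((cosh t)\<^sup>2) x" if x: "x \<in> {0..1}" for x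
  proof -
    have sub: "{0..x} \<subseteq> {0..1}"
      using x by simp
    have "(LINT y|lebesgue_on {0..\<phi> t x}. ?h y) = (LINT y|lebesgue_on {0..x}. G t y * ?h (\<phi> t y))"
      by (rule change_of_variables_initial[OF h x])
    also have "\<dots> = (LINT y|circle_measure. indicator {0..x} y * (G t y * ?h (\<phi> t y)))"
      by (rule integral_circle_indicator[OF sub, symmetric])
    also have "\<dots> = (LINT y|circle_measure. indicator {0..x} y * (4 * ?l y))"
    proof (rule integral_cong_AE)
      have i: "indicator {0..x} \<in> borel_measurable circle_measure"
        by (intro measurable_restrict_space1 measurable_completion borel_measurable_indicator) simp
      show "(\<lambda>y. indicator {0..x} y * (G t y * ?h (\<phi> t y))) \<in> borel_measurable circle_measure"
        using i hm by (intro borel_measurable_times) simp_all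
      show "(\<lambda>y. indicator {0..x} y * (4 * ?l y)) \<in> borel_measurable circle_measure"
        using i borel_measurable_integrable[OF lin_integrable] by (intro borel_measurable_times) simp_all
      show "AE y in circle_measure. indicator {0..x} y * (G t y * ?h (\<phi> t y)) = indicator {0..x} y * (4 * ?l y)"
        using ae by eventually_elim simp
    qed
    also have "\<dots> = (LINT y|lebesgue_on {0..x}. 4 * ?l y)"
      by (rule integral_circle_indicator[OF sub])
    also have "\<dots> = 4 * Lin ((sinh t)\<^sup>2) (2 * sinh t * cosh t) ((cosh t)\<^sup>2) x"
      unfolding Lin_def by (rule integral_mult_right_zero)
    finally show ?thesis .
  qed
  have total: "(LINT y|circle_measure. ?h y) = - 4"
    using int[of 1] by (simp add: \<phi>_1 Lin_1 sinh_square_eq)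
  \<comment> \<open>With total \<open>- 4\<close> the right-hand side is twice the integrated energy
    density plus \<open>2 * \<phi> t x\<close>. Adding coefficients gives exactly those of
    \<open>Dtt\<phi>\<close>.\<close>
  have "tderiv (tderiv \<phi>) t x = 1 / 2 * ((LINT y|lebesgue_on {0..\<phi> t x}. ?h y) - \<phi> t x * (LINT y|circle_measure. ?h y))"
    if x: "x \<in> {0..1}" for x
    unfolding int[OF x] total tderiv_tderiv_\<phi>[OF x t] Dtt\<phi>_def
    unfolding \<phi>_Lin Lin_eq[OF x]
    by (simp add: algebra_simps)
  moreover have "AE x in circle_measure. tderiv (tderiv \<alpha>) t x
      = 1 / 2 * (- (xderiv u (\<phi> t x) * \<rho> (\<phi> t x) + xderiv u (\<phi> t x) * \<rho> (\<phi> t x)))"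
    using pt
  proof eventually_elim
    case (elim x)
    then show ?case
      using tderiv_tderiv_\<alpha>[of x t] t by (simp add: power2_eq_square)
  qed
  ultimately show ?thesis
    unfolding christoffel.simps pb christoffel_formula.simps by simp
qed

end

theorem theorem4p1:
  fixes u0 \<rho>0 :: "real \<Rightarrow> real" and c :: real
    and f1 f2 \<phi> \<alpha> :: "real \<Rightarrow> real \<Rightarrow> real"
  assumes tangent: "(u0, \<rho>0) \<in> T_id"
    and c_def: "c = 1 / 4 * (LINT x|circle_measure. (xderiv u0 x)\<^sup>2 - (\<rho>0 x)\<^sup>2)"
    and A: "c = -1"
    and B: "AE x in circle_measure. \<bar>\<rho>0 x\<bar> \<le> xderiv u0 x + 2"
    and f1_def: "f1 = (\<lambda>t x. cosh t + xderiv u0 x / 2 * sinh t)"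
    and f2_def: "f2 = (\<lambda>t x. \<rho>0 x / 2 * sinh t)"
    and \<phi>_def: "\<phi> = (\<lambda>t x. LINT y|lebesgue_on {0..x}. (f1 t y)\<^sup>2 - (f2 t y)\<^sup>2)"
    and \<alpha>_def: "\<alpha> = (\<lambda>t x. 2 * artanh (f2 t x / f1 t x))"
  shows
    \<comment> \<open>the second expression for \<open>\<alpha>\<close>\<close>
    "(AE x in circle_measure. \<forall>t\<ge>0.
        integrable (lebesgue_on {0..t}) (\<lambda>s. 1 / xderiv (\<phi> s) x) \<and>
        \<alpha> t x = \<rho>0 x * (LINT s|lebesgue_on {0..t}. 1 / xderiv (\<phi> s) x))
   \<and> \<comment> \<open>existence of the time derivatives\<close>
     (\<forall>x\<in>{0..1}. \<forall>t\<ge>0. (\<lambda>s. \<phi> s x) differentiable (at t within {0..}) \<and>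
                         (\<lambda>s. tderiv \<phi> s x) differentiable (at t within {0..}))
   \<and> (AE x in circle_measure. \<forall>t\<ge>0. (\<lambda>s. \<alpha> s x) differentiable (at t within {0..}) \<and>
                         (\<lambda>s. tderiv \<alpha> s x) differentiable (at t within {0..}))
   \<and> \<comment> \<open>(i)\<close>
     (\<forall>t\<ge>0. (\<phi> t, \<alpha> t) \<in> M_AC)
   \<and> \<comment> \<open>(ii)\<close>
     (\<forall>t\<ge>0. (tderiv \<phi> t, tderiv \<alpha> t) \<in> T_M_AC (\<phi> t, \<alpha> t))
   \<and> \<comment> \<open>(iii)\<close>
     (\<forall>t\<ge>0. indef_metric (\<phi> t, \<alpha> t) (tderiv \<phi> t, tderiv \<alpha> t) (tderiv \<phi> t, tderiv \<alpha> t) = -1)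
   \<and> \<comment> \<open>(iv)\<close>
     (\<forall>t\<ge>0. case christoffel (\<phi> t, \<alpha> t) (tderiv \<phi> t, tderiv \<alpha> t) (tderiv \<phi> t, tderiv \<alpha> t)
              of (\<Gamma>1, \<Gamma>2) \<Rightarrow>
        (\<forall>x\<in>{0..1}. tderiv (tderiv \<phi>) t x = \<Gamma>1 x) \<and>
        (AE x in circle_measure. tderiv (tderiv \<alpha>) t x = \<Gamma>2 x))"
proof -
  have u0: "abs_continuous u0" "u0 0 = u0 1"
      "AE x in circle_measure. u0 differentiable (at x within {0..1})" "xderiv u0 \<in> L2"
    and \<rho>0: "\<rho>0 \<in> L2"
    using tangent by (auto simp: T_id_def H1_0_def)
  define a where "a = (\<lambda>x. xderiv u0 x / 2)"
  define b where "b = (\<lambda>x. \<rho>0 x / 2)"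
  have am: "a \<in> borel_measurable circle_measure" and bm: "b \<in> borel_measurable circle_measure"
    using u0(4) \<rho>0 by (auto simp: a_def b_def L2_def intro!: borel_measurable_divide)
  have a2: "integrable circle_measure (\<lambda>x. (a x)\<^sup>2)" and b2: "integrable circle_measure (\<lambda>x. (b x)\<^sup>2)"
    using u0(4) \<rho>0 by (simp_all add: a_def b_def L2_def power_divide)
  interpret gd: geodesic_data a b
  proof
    \<comment> \<open>The mean vanishes because \<open>u0\<close> is absolutely continuous and
      periodic.\<close>
    show "(LINT x|circle_measure. a x) = 0"
      using abs_continuous_FTC[OF u0(1,3) L2_integrable[OF u0(4)]] u0(2) by (simp add: a_def)
    have "(\<lambda>x. (a x)\<^sup>2 - (b x)\<^sup>2) = (\<lambda>x. 1 / 4 * ((xderiv u0 x)\<^sup>2 - (\<rho>0 x)\<^sup>2))"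
      by (simp add: a_def b_def power_divide fun_eq_iff diff_divide_distrib)
    then have "(LINT x|circle_measure. (a x)\<^sup>2 - (b x)\<^sup>2)
        = 1 / 4 * (LINT x|circle_measure. (xderiv u0 x)\<^sup>2 - (\<rho>0 x)\<^sup>2)"
      by (simp only: integral_mult_right_zero)
    then show "(LINT x|circle_measure. (a x)\<^sup>2 - (b x)\<^sup>2) = -1"
      using c_def A by simp
    show "AE x in circle_measure. \<bar>b x\<bar> \<le> a x + 1"
      using B by eventually_elim (simp add: a_def b_def)
  qed (fact am bm a2 b2)+
  have f12: "f1 t y = cosh t + a y * sinh t" "f2 t y = b y * sinh t" for t y
    by (simp_all add: f1_def f2_def a_def b_def)
  \<comment> \<open>The difference of squares factors into \<open>f1 + f2\<close> and
    \<open>f1 - f2\<close>, the functions \<open>P\<close> and \<open>Q\<close>.\<close>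
  have f: "(f1 t y)\<^sup>2 - (f2 t y)\<^sup>2 = gd.G t y" for t y
    by (simp add: f12 gd.G_def gd.P_def gd.Q_def algebra_simps power2_eq_square)
  have \<phi>: "\<phi> = gd.\<phi>"
    unfolding \<phi>_def f by (simp add: fun_eq_iff gd.\<phi>_def)
  have \<alpha>: "\<alpha> = gd.\<alpha>"
    unfolding \<alpha>_def by (simp add: fun_eq_iff gd.\<alpha>_def f12)
  have b: "2 * b x = \<rho>0 x" for x
    by (simp add: b_def)
  show ?thesis
    unfolding \<phi> \<alpha>
  proof (intro conjI)
    show "AE x in circle_measure. \<forall>t\<ge>0.
        integrable (lebesgue_on {0..t}) (\<lambda>s. 1 / xderiv (gd.\<phi> s) x) \<and>
        gd.\<alpha> t x = \<rho>0 x * (LINT s|lebesgue_on {0..t}. 1 / xderiv (gd.\<phi> s) x)"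
      using gd.AE_good
      by eventually_elim (intro allI impI conjI; use gd.\<alpha>_integral in \<open>simp only: b[symmetric]\<close>)
    show "\<forall>x\<in>{0..1}. \<forall>t\<ge>0. (\<lambda>s. gd.\<phi> s x) differentiable (at t within {0..}) \<and>
                         (\<lambda>s. tderiv gd.\<phi> s x) differentiable (at t within {0..})"
      unfolding real_differentiable_def
      using gd.\<phi>_tderiv gd.tderiv_\<phi>_has_tderiv by blast
    show "AE x in circle_measure. \<forall>t\<ge>0. (\<lambda>s. gd.\<alpha> s x) differentiable (at t within {0..}) \<and>
                         (\<lambda>s. tderiv gd.\<alpha> s x) differentiable (at t within {0..})"
      using gd.AE_good unfolding real_differentiable_def
      by eventually_elim (use gd.\<alpha>_has_tderiv gd.tderiv_\<alpha>_has_tderiv in blast)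
    show "\<forall>t\<ge>0. (gd.\<phi> t, gd.\<alpha> t) \<in> M_AC"
      unfolding M_AC_def using circle_homeomorphism.\<phi>_M_AC[OF gd.homeomorphism] gd.\<alpha>_L2 by blast
  qed (use gd.velocity_tangent gd.velocity_norm gd.geodesic_equation in blast)+
qed

end
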